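(* Let $\dot\omega=v(\omega)$, $\omega\in\mathbb{R}^p$, be the reduced Euler--Poincaré--Suslov system with $p=n-m\ge2$, and let $\omega_0\ne0$ be a steady motion, i.e. $v(\omega_0)=0$, such that $s(\omega_0)=n-m-1$. Then the equilibrium $\omega_0$ is (Lyapunov) stable; moreover, every solution starting sufficiently close to $\omega_0$ converges, as $t\to+\infty$, to one of the equilibria on the line $\{\mu\omega_0:\mu\in\mathbb{R}\}$. On the other hand, the steady motion $\omega=-\omega_0$ is unstable.
   Context: Setting (Euler--Poincaré--Suslov, EPS, systems). Let $G$ be an $n$-dimensional real Lie group with Lie algebra $g$, and let $w_1,\dots,w_n$ be a basis of left-invariant vector fields with $[w_i,w_j]=\sum_{k=1}^n c_{ij}^k w_k$, $c_{ij}^k=-c_{ji}^k$ (structure constants). Let $\omega_1,\dots,\omega_n$ be the corresponding linear coordinates on $g$ (quasi-velocities). The left-invariant kinetic energy is $T=\frac12\sum_{i,j} I_{ij}\omega_i\omega_j$, where $\|I_{ij}\|$ is a constant symmetric positive definite matrix, and $m_i=\partial T/\partial\omega_i=\sum_j I_{ij}\omega_j$. There are $m<n$ linearly independent left-invariant constraints $f_1(\omega)=\dots=f_m(\omega)=0$, linear in $\omega$ with constant coefficients. The equations of motion are $$\dot m_i=\sum_{j,k=1}^n c_{ji}^k m_k\omega_j+\sum_{q=1}^m\lambda_q\frac{\partial f_q}{\partial\omega_i},\quad 1\le i\le n,\qquad f_1(\omega)=\dots=f_m(\omega)=0,$$ with Lagrange multipliers $\lambda_q$. Put $p=n-m$ and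 assume $p\ge 2$. The basis is chosen so that $f_1=\omega_{p+1},\dots,f_m=\omega_n$. Setting $\omega_{p+1}=\dots=\omega_n=0$, the first $p$ equations $$\sum_{j=1}^p I_{ij}\dot\omega_j=\sum_{j=1}^p\sum_{k=1}^n c_{ji}^k\Big(\sum_{l=1}^p I_{kl}\omega_l\Big)\omega_j,\quad 1\le i\le p,$$ form a closed system, the reduced EPS system, written $\dot\omega=v(\omega)$, $\omega=(\omega_1,\dots,\omega_p)^\top\in\mathbb{R}^p$. The components $v_1,\dots,v_p$ are homogeneous polynomials of degree 2 (so $v(\lambda\omega)=\lambda^2v(\omega)$), and the system has the first integral $H$, the restriction of $T$ to the constraint subspace, which is a positive definite quadratic form. A steady motion is a point $\omega_0\in\mathbb{R}^p$ with $v(\omega_0)=0$; then $\mu\omega_0$ is a steady motion for every $\mu\in\mathbb{R}$. For a steady motion $\omega_*$, $s(\omega_* )$ denotes the number of eigenvalues, counted with algebraic multiplicity, of the linearization operator $\frac{\partial v}{\partial\omega}\big|_{\omega_*}$ lying in the open left complex half-plane. *)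

theory Defs
  imports "HOL-Analysis.Analysis" "HOL-Computational_Algebra.Computational_Algebra"
begin

locale real_lie_algebra =
  fixes bracket :: "'g::real_vector \<Rightarrow> 'g \<Rightarrow> 'g"
  assumes bilinear_bracket: "bilinear bracket"
    and bracket_self: "bracket x x = 0"
    and jacobi: "bracket x (bracket y z) + bracket y (bracket z x) + bracket z (bracket x y) = 0"

text \<open>
  The Lie group enters the Euler--Poincare--Suslov equations only through its Lie algebra
  (the left-invariant fields), with basis \<open>w\<close> and structure constants
  \<open>[w i, w j] = (\<Sum>k. c i j k *\<^sub>R w k)\<close>.  The basis is adapted to the constraints: these are
  \<open>\<omega> i = 0\<close> for \<open>i\<close> outside the range of the injection \<open>emb\<close>, which plays the role of the
  inclusion of the first \<open>p\<close> indices into \<open>{1..n}\<close>.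
\<close>

locale eps_system = real_lie_algebra bracket
  for bracket :: "'g::real_vector \<Rightarrow> 'g \<Rightarrow> 'g" +
  fixes w :: "'n::finite \<Rightarrow> 'g"
    and c :: "'n \<Rightarrow> 'n \<Rightarrow> 'n \<Rightarrow> real"
    and J :: "real^'n^'n"
    and emb :: "'p::finite \<Rightarrow> 'n"
  assumes basis_inj: "inj w"
    and basis_independent: "independent (range w)"
    and basis_span: "span (range w) = UNIV"
    and structure_constants: "bracket (w i) (w j) = (\<Sum>k\<in>UNIV. c i j k *\<^sub>R w k)"
    and inertia_symmetric: "transpose J = J"
    and inertia_pos_def: "x \<noteq> 0 \<Longrightarrow> x \<bullet> (J *v x) > 0"
    and emb_inj: "inj emb"

definition reduced_inertia :: "real^'n^'n \<Rightarrow> ('p \<Rightarrow> 'n) \<Rightarrow> real^'p^'p" where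
  "reduced_inertia J emb = (\<chi> i j. J $ emb i $ emb j)"

definition eps_rhs ::
    "('n::finite \<Rightarrow> 'n \<Rightarrow> 'n \<Rightarrow> real) \<Rightarrow> real^'n^'n \<Rightarrow> ('p::finite \<Rightarrow> 'n) \<Rightarrow> real^'p \<Rightarrow> real^'p" where
  "eps_rhs c J emb \<omega> =
     (\<chi> i. \<Sum>j\<in>UNIV. \<Sum>k\<in>UNIV.
        c (emb j) (emb i) k * (\<Sum>l\<in>UNIV. J $ k $ emb l * \<omega> $ l) * \<omega> $ j)"

definition eps_field ::
    "('n::finite \<Rightarrow> 'n \<Rightarrow> 'n \<Rightarrow> real) \<Rightarrow> real^'n^'n \<Rightarrow> ('p::finite \<Rightarrow> 'n) \<Rightarrow> real^'p \<Rightarrow> real^'p" where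
  "eps_field c J emb \<omega> = matrix_inv (reduced_inertia J emb) *v eps_rhs c J emb \<omega>"

definition charpoly :: "real^'p^'p \<Rightarrow> complex poly" where
  "charpoly A = det (\<chi> i j. (if i = j then [:0, 1:] else 0) - [:complex_of_real (A $ i $ j):])"

definition stable_degree :: "(real^'p \<Rightarrow> real^'p) \<Rightarrow> real^'p \<Rightarrow> nat" where
  "stable_degree v a = size {# z \<in># proots (charpoly (jacobian v (at a))). Re z < 0 #}"

definition solution_on :: "('a::real_normed_vector \<Rightarrow> 'a) \<Rightarrow> (real \<Rightarrow> 'a) \<Rightarrow> real set \<Rightarrow> bool" where
  "solution_on v x S \<longleftrightarrow> (\<forall>t\<in>S. (x has_vector_derivative v (x t)) (at t within S))"

text \<open>
  All solutions on all intervals \<open>[0, T)\<close> are quantified over, so that a solution escaping in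
  finite time also violates stability.
\<close>

definition lyapunov_stable :: "('a::real_normed_vector \<Rightarrow> 'a) \<Rightarrow> 'a \<Rightarrow> bool" where
  "lyapunov_stable v a \<longleftrightarrow>
     (\<forall>\<epsilon>>0. \<exists>\<delta>>0. \<forall>T>0. \<forall>x. solution_on v x {0..<T} \<and> dist (x 0) a < \<delta> \<longrightarrow>
        (\<forall>t\<in>{0..<T}. dist (x t) a < \<epsilon>))"

context eps_system
begin

lemma invertible_reduced_inertia: "invertible (reduced_inertia J emb)"
proof -
  have "y = 0" if y: "reduced_inertia J emb *v y = 0" for y :: "real^'p"
  proof (rule ccontr)
    assume "y \<noteq> 0"
    define x :: "real^'n" where "x = (\<chi> i. if i \<in> range emb then y $ inv emb i else 0)"
    have xe: "x $ emb a = y $ a" for a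
      using emb_inj by (simp add: x_def)
    have x0: "x $ i = 0" if "i \<notin> range emb" for i
      using that by (simp add: x_def)
    have red: "(\<Sum>i\<in>UNIV. f i * x $ i) = (\<Sum>a\<in>UNIV. f (emb a) * y $ a)" for f :: "'n \<Rightarrow> real"
    proof -
      have "(\<Sum>i\<in>UNIV. f i * x $ i) = (\<Sum>i\<in>range emb. f i * x $ i)"
        by (rule sum.mono_neutral_right) (auto simp: x0)
      also have "\<dots> = (\<Sum>a\<in>UNIV. f (emb a) * y $ a)"
        using emb_inj by (simp add: sum.reindex xe)
      finally show ?thesis .
    qed
    have "x \<noteq> 0"
      using \<open>y \<noteq> 0\<close> xe by (metis vec_eq_iff zero_index)
    then have "x \<bullet> (J *v x) > 0" by (rule inertia_pos_def)
    moreover have "x \<bullet> (J *v x) = (\<Sum>i\<in>UNIV. (J *v x) $ i * x $ i)"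
      by (simp add: inner_vec_def mult.commute)
    moreover have "\<dots> = (\<Sum>a\<in>UNIV. (reduced_inertia J emb *v y) $ a * y $ a)"
      unfolding red by (simp add: matrix_vector_mult_def reduced_inertia_def red)
    ultimately show False using y by simp
  qed
  then show ?thesis
    by (simp add: invertible_left_inverse matrix_left_invertible_ker)
qed

lemma eps_field_iff:
  "\<omega>' = eps_field c J emb \<omega> \<longleftrightarrow> reduced_inertia J emb *v \<omega>' = eps_rhs c J emb \<omega>"
proof -
  let ?A = "reduced_inertia J emb"
  have "?A ** matrix_inv ?A = mat 1 \<and> matrix_inv ?A ** ?A = mat 1"
    using invertible_reduced_inertia unfolding invertible_def matrix_inv_def by (rule someI_ex)
  then show ?thesis
    unfolding eps_field_def by (metis matrix_vector_mul_assoc matrix_vector_mul_lid)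
qed

text \<open>
  On the constraint subspace, the equations with Lagrange multipliers are equivalent to the
  reduced system.
\<close>

lemma eps_with_multipliers_iff:
  fixes \<omega> \<omega>' :: "real^'n"
  assumes on_subspace: "\<And>i. i \<notin> range emb \<Longrightarrow> \<omega> $ i = 0" and on_subspace': "\<And>i. i \<notin> range emb \<Longrightarrow> \<omega>' $ i = 0"
  shows "(\<exists>lam. \<forall>i. (J *v \<omega>') $ i =
            (\<Sum>j\<in>UNIV. \<Sum>k\<in>UNIV. c j i k * (J *v \<omega>) $ k * \<omega> $ j)
            + (\<Sum>q\<in>- range emb. lam q * (if q = i then 1 else 0)))
         \<longleftrightarrow> (\<chi> a. \<omega>' $ emb a) = eps_field c J emb (\<chi> a. \<omega> $ emb a)"
    (is "(\<exists>lam. \<forall>i. ?L i = ?R i + ?M lam i) \<longleftrightarrow> _")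
proof -
  have red: "(\<Sum>i\<in>UNIV. f i * x $ i) = (\<Sum>a\<in>UNIV. f (emb a) * x $ emb a)"
    if "\<And>i. i \<notin> range emb \<Longrightarrow> x $ i = 0" for f :: "'n \<Rightarrow> real" and x :: "real^'n"
  proof -
    have "(\<Sum>i\<in>UNIV. f i * x $ i) = (\<Sum>i\<in>range emb. f i * x $ i)"
      by (rule sum.mono_neutral_right) (auto simp: that)
    also have "\<dots> = (\<Sum>a\<in>UNIV. f (emb a) * x $ emb a)"
      using emb_inj by (simp add: sum.reindex)
    finally show ?thesis .
  qed
  have L: "?L (emb a) = (reduced_inertia J emb *v (\<chi> a. \<omega>' $ emb a)) $ a" for a
    by (simp add: matrix_vector_mult_def reduced_inertia_def red[OF on_subspace'])
  have R: "?R (emb a) = eps_rhs c J emb (\<chi> a. \<omega> $ emb a) $ a" for a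
    by (simp add: matrix_vector_mult_def eps_rhs_def red[OF on_subspace] flip: sum_distrib_right)
  have M: "?M lam i = (if i \<in> range emb then 0 else lam i)" for lam i
    by (simp add: if_distrib cong: if_cong)
  have "(\<exists>lam. \<forall>i. ?L i = ?R i + ?M lam i) \<longleftrightarrow> (\<forall>a. ?L (emb a) = ?R (emb a))"
  proof
    assume "\<forall>a. ?L (emb a) = ?R (emb a)"
    then have "\<forall>i. ?L i = ?R i + ?M (\<lambda>i. ?L i - ?R i) i"
      unfolding M by auto
    then show "\<exists>lam. \<forall>i. ?L i = ?R i + ?M lam i" by (rule exI[where x = "\<lambda>i. ?L i - ?R i"])
  next
    assume "\<exists>lam. \<forall>i. ?L i = ?R i + ?M lam i"
    then show "\<forall>a. ?L (emb a) = ?R (emb a)" unfolding M by auto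
  qed
  also have "\<dots> \<longleftrightarrow> (\<chi> a. \<omega>' $ emb a) = eps_field c J emb (\<chi> a. \<omega> $ emb a)"
    unfolding L R eps_field_iff by (simp add: vec_eq_iff)
  finally show ?thesis .
qed

end

end

theory Submission
  imports Defs
begin

text \<open>
  Let \<open>a\<close> be the steady motion, \<open>g\<close> the polarised energy and write \<open>x = r a + y\<close> with \<open>y\<close>
  \<open>g\<close>-orthogonal to \<open>a\<close>. The linearization at \<open>a\<close> kills \<open>a\<close> and, by differentiating the energy
  identity, maps into the complement of \<open>a\<close>, where its eigenvalues all lie in the left half-plane.
  Since the field is quadratic, \<open>y' = r A y + O(\<bar>y\<bar>\<^sup>2)\<close>: a Lyapunov form of \<open>A\<close> on the complement
  decreases exponentially near \<open>a\<close> (\<open>r > 0\<close>) and increases exponentially near \<open>-a\<close> (\<open>r < 0\<close>).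
  Conservation of energy then controls \<open>r\<close>, so that no centre manifold is needed.
\<close>

text \<open>The spectral hypothesis counts roots of a polynomial on the whole space, whereas the
  Lyapunov estimate is wanted on a hyperplane. Nothing is restricted to the hyperplane: a rank one
  matrix vanishing there is added to the linearization, which makes it Hurwitz, and the form built
  for the sum on the whole space is evaluated only on the hyperplane. That form comes from an
  annihilating product of linear factors over the complex numbers, whose partial products play the
  part of a Jordan chain.

  Along the line the motion is neutral, and the energy fixes only \<open>r^2\<close>; confinement to
  \<open>r \<ge> 1/2\<close> selects the root. The bound on \<open>r\<close> relies on decay of
  \<open>y\<close>, which in turn presupposes that \<open>r\<close> stays near 1, hence a first-exit
  argument.

  Stability quantifies over existing solutions, so refuting it at \<open>-a\<close> requires a
  solution that lasts long enough to leave. This is why global existence is established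
  first.\<close>

section \<open>Global solutions\<close>

text \<open>Picard iteration in the weighted unknown \<open>g t = exp (- K t) x t\<close>: with this
  weight the integral operator contracts by \<open>L / K\<close> on the whole half-line at once, so
  no local solutions have to be glued. Boundedness of \<open>f\<close> keeps the weighted iterates
  bounded.\<close>

lemma global_solution_exists:
  fixes f :: "'a::banach \<Rightarrow> 'a"
  assumes lip: "L-lipschitz_on UNIV f" and bdd: "bounded (range f)"
  shows "\<exists>x. solution_on f x {0..} \<and> x 0 = a"
proof -
  have L: "L \<ge> 0" using lip by (rule lipschitz_on_nonneg)
  have f_lip: "norm (f x - f y) \<le> L * norm (x - y)" for x y
    using lipschitz_onD[OF lip, of x y] by (simp add: dist_norm)
  have cont_f: "continuous_on UNIV f" using lip by (rule lipschitz_on_continuous_on)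
  obtain M where M: "\<And>x. norm (f x) \<le> M" and "M > 0"
    using bdd by (auto simp: bounded_pos)
  \<comment> \<open>The summand 1 keeps \<open>K\<close> positive when \<open>L = 0\<close>, and
    \<open>K \<ge> 1\<close> serves in bounding the iterates.\<close>
  define K where "K = 2 * L + 1"
  have K: "K \<ge> 1" "K > 0" using L by (auto simp: K_def)
  define u where "u g s = f (exp (K * s) *\<^sub>R apply_bcontfun g s)" for g s
  have cont_u: "continuous_on S (u g)" for S g
    unfolding u_def
    by (rule continuous_on_compose2[OF cont_f]) (auto intro!: continuous_intros)
  \<comment> \<open>Bounded continuous functions live on the whole real line here;
    \<open>max 0 t\<close> extends the operator to negative times by the constant
    \<open>a\<close>.\<close>
  define \<Phi> where "\<Phi> g t = exp (- K * max 0 t) *\<^sub>R (a + integral {0..max 0 t} (u g))" for g t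
  have \<Phi>_in: "\<Phi> g \<in> bcontfun" for g
  proof -
    have "continuous (at t within {0..}) (\<lambda>t. integral {0..t} (u g))" if "t \<ge> 0" for t
    proof -
      have "continuous_on {0..t + 1} (\<lambda>t. integral {0..t} (u g))"
        by (intro indefinite_integral_continuous_1 integrable_continuous_real cont_u)
      moreover have "at t within {0..t + 1} = at t within {0..}"
        by (rule at_within_nhd[where S = "{..<t + 1}"]) auto
      ultimately show ?thesis
        using that by (metis atLeastAtMost_iff continuous_on_eq_continuous_within
            le_add_same_cancel1 zero_le_one)
    qed
    then have "continuous_on {0..} (\<lambda>t. integral {0..t} (u g))"
      by (simp add: continuous_on_eq_continuous_within)
    then have "continuous_on UNIV (\<lambda>t. integral {0..max 0 t} (u g))"
      by (rule continuous_on_compose2) (auto intro!: continuous_intros)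
    then have "continuous_on UNIV (\<Phi> g)"
      unfolding \<Phi>_def by (intro continuous_intros)
    moreover have "norm (\<Phi> g t) \<le> norm a + M" for t
    proof -
      let ?t = "max 0 t"
      have "norm (integral {0..?t} (u g)) \<le> M * (?t - 0)"
        by (rule integral_bound[OF _ cont_u]) (auto simp: u_def M)
      then have "norm (a + integral {0..?t} (u g)) \<le> norm a + M * ?t"
        by (intro norm_triangle_le) simp
      also have "\<dots> \<le> (norm a + M) * (1 + K * ?t)"
      proof -
        have "M * \<tau> \<le> (norm a + M) * (K * \<tau>)" if "\<tau> \<ge> 0" for \<tau>
          using K \<open>M > 0\<close> that mult_right_mono[of 1 K \<tau>] by (intro mult_mono) auto
        from this[of ?t] show ?thesis using \<open>M > 0\<close> by (simp only: distrib_left) simp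
      qed
      also have "\<dots> \<le> (norm a + M) * exp (K * ?t)"
        using \<open>M > 0\<close> by (intro mult_left_mono exp_ge_add_one_self) auto
      finally have "norm (a + integral {0..?t} (u g)) / exp (K * ?t) \<le> norm a + M"
        by (simp only: pos_divide_le_eq exp_gt_zero)
      moreover have "norm (\<Phi> g t) = norm (a + integral {0..?t} (u g)) / exp (K * ?t)"
        unfolding \<Phi>_def norm_scaleR by (simp add: exp_minus divide_inverse mult.commute)
      ultimately show ?thesis by simp
    qed
    ultimately show ?thesis
      by (auto simp: bcontfun_def bounded_iff)
  qed
  have contr: "dist (Bcontfun (\<Phi> g)) (Bcontfun (\<Phi> h)) \<le> (L / K) * dist g h" for g h
  proof (rule dist_bound)
    fix t :: real
    let ?t = "max 0 t"
    let ?E = "\<lambda>s. L * dist g h / K * exp (K * s)"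
    have "((\<lambda>s. L * dist g h * exp (K * s)) has_integral (?E ?t - ?E 0)) {0..?t}"
      using K by (intro fundamental_theorem_of_calculus)
        (auto simp: has_real_derivative_iff_has_vector_derivative[symmetric] intro!: derivative_eq_intros)
    note int = has_integral_integrable[OF this] and val = integral_unique[OF this]
    have pw: "norm (u g s - u h s) \<le> L * dist g h * exp (K * s)" for s
    proof -
      have "norm (u g s - u h s) \<le> L * (exp (K * s) * norm (g s - h s))"
        unfolding u_def using f_lip[of "exp (K * s) *\<^sub>R g s" "exp (K * s) *\<^sub>R h s"]
        by (simp flip: scaleR_diff_right)
      also have "\<dots> \<le> L * (exp (K * s) * dist g h)"
        using L dist_bounded[of g s h] by (intro mult_left_mono) (auto simp: dist_norm)
      finally show ?thesis by (simp add: ac_simps)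
    qed
    have "norm (integral {0..?t} (u g) - integral {0..?t} (u h))
        = norm (integral {0..?t} (\<lambda>s. u g s - u h s))"
      by (subst integral_diff) (auto intro!: integrable_continuous_real cont_u)
    also have "\<dots> \<le> ?E ?t - ?E 0"
      unfolding val[symmetric]
      by (rule integral_norm_bound_integral[OF _ int])
        (auto intro!: integrable_continuous_real continuous_intros cont_u pw)
    also have "\<dots> \<le> ?E ?t" using K L by simp
    finally have "exp (- K * ?t) * norm (integral {0..?t} (u g) - integral {0..?t} (u h))
        \<le> exp (- K * ?t) * ?E ?t"
      by (rule mult_left_mono) simp
    moreover have "exp (- K * ?t) * ?E ?t = L / K * dist g h"
      by (simp add: exp_minus)
    moreover have "\<Phi> g t - \<Phi> h t = exp (- K * ?t) *\<^sub>R (integral {0..?t} (u g) - integral {0..?t} (u h))"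
      by (simp add: \<Phi>_def algebra_simps)
    ultimately show "dist (Bcontfun (\<Phi> g) t) (Bcontfun (\<Phi> h) t) \<le> (L / K) * dist g h"
      by (simp only: Bcontfun_inverse[OF \<Phi>_in] dist_norm norm_scaleR abs_exp_cancel)
  qed
  obtain g where g: "Bcontfun (\<Phi> g) = g"
    using banach_fix_type[of "L / K" "\<lambda>g. Bcontfun (\<Phi> g)"] contr K L
    by (auto simp: K_def)
  define x where "x t = exp (K * t) *\<^sub>R g t" for t
  have u_eq: "u g = (\<lambda>s. f (x s))" by (simp add: fun_eq_iff u_def x_def)
  have x_eq: "x t = a + integral {0..t} (\<lambda>s. f (x s))" if "t \<ge> 0" for t
  proof -
    have "g t = \<Phi> g t" by (metis g Bcontfun_inverse[OF \<Phi>_in])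
    then show ?thesis using that
      unfolding x_def[of t] by (simp add: \<Phi>_def u_eq exp_minus)
  qed
  have "(x has_vector_derivative f (x t)) (at t within {0..})" if "t \<ge> 0" for t
  proof -
    have "((\<lambda>t. a + integral {0..t} (\<lambda>s. f (x s))) has_vector_derivative 0 + f (x t))
        (at t within {0..t + 1})"
      using that cont_u[of _ g] unfolding u_eq
      by (intro has_vector_derivative_add integral_has_vector_derivative) auto
    then have "(x has_vector_derivative f (x t)) (at t within {0..t + 1})"
      using that x_eq by (intro has_vector_derivative_transform[of t "{0..t + 1}" x]) auto
    moreover have "at t within {0..t + 1} = at t within {0..}"
      by (rule at_within_nhd[where S = "{..<t + 1}"]) auto
    ultimately show ?thesis by simp
  qed
  moreover have "x 0 = a" by (simp add: x_eq)
  ultimately show ?thesis by (auto simp: solution_on_def)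
qed

section \<open>Quadratic fields with a positive definite quadratic first integral\<close>

lemma bilinear_bounded:
  fixes \<beta> :: "'a::euclidean_space \<Rightarrow> 'b::euclidean_space \<Rightarrow> 'c::real_normed_vector"
  assumes "bilinear \<beta>"
  obtains B where "B > 0" "\<And>x y. norm (\<beta> x y) \<le> B * norm x * norm y"
  using bounded_bilinear.pos_bounded[of \<beta>] assms bilinear_conv_bounded_bilinear[of \<beta>]
  by (metis mult.commute mult.left_commute)

text \<open>Radiality is what matters: if the projection of \<open>x\<close> is \<open>s x\<close>,
  the truncated field at \<open>x\<close> is \<open>s^2\<close> times the original one, so it stays
  tangent to the energy levels.\<close>

lemma closest_point_cball_0:
  fixes x :: "'a::euclidean_space"
  assumes "R \<ge> 0"
  shows "\<exists>s. closest_point (cball 0 R) x = s *\<^sub>R x"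
proof (cases "norm x \<le> R")
  case True
  then show ?thesis by (intro exI[of _ 1]) (simp add: closest_point_self)
next
  case False
  let ?z = "(R / norm x) *\<^sub>R x"
  have x: "norm x > 0" using False assms by linarith
  have "x - ?z = (1 - R / norm x) *\<^sub>R x" by (simp add: algebra_simps)
  then have "norm (x - ?z) = \<bar>1 - R / norm x\<bar> * norm x" by simp
  also have "\<dots> = norm x - R"
    using False x assms by (simp add: abs_if field_simps)
  finally have d: "dist x ?z = norm x - R" by (simp add: dist_norm)
  have "norm x - R \<le> dist x z" if "norm z \<le> R" for z
    using norm_triangle_ineq2[of x z] that by (simp add: dist_norm)
  then have "?z = closest_point (cball 0 R) x"
    using x assms by (intro closest_point_unique) (auto simp: d)
  then show ?thesis by metis
qed

lemma constant_on_interval: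
  fixes f :: "real \<Rightarrow> real"
  assumes "convex S" and "\<And>t. t \<in> S \<Longrightarrow> (f has_real_derivative 0) (at t within S)"
    and "s \<in> S" "t \<in> S"
  shows "f s = f t"
  using has_field_derivative_zero_constant[OF assms(1,2)] assms(3,4) by metis

text \<open>The field \<open>v\<close> is arbitrary because the truncated field is treated before it
  is known to agree with the quadratic one along the solution.\<close>

lemma quadratic_first_integral:
  fixes g :: "'a::euclidean_space \<Rightarrow> 'a \<Rightarrow> real"
  assumes g: "bilinear g" "\<And>x y. g x y = g y x" and first: "\<And>x. g x (v x) = 0"
    and sol: "solution_on v x S" and S: "convex S" "s \<in> S" "t \<in> S"
  shows "g (x s) (x s) = g (x t) (x t)"
proof -
  have "bounded_bilinear g" using g by (simp add: bilinear_conv_bounded_bilinear)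
  then have "((\<lambda>s. g (x s) (x s)) has_vector_derivative g (x s) (v (x s)) + g (v (x s)) (x s)) (at s within S)"
    if "s \<in> S" for s
    using sol that unfolding solution_on_def
    by (intro bounded_bilinear.has_vector_derivative) auto
  then show ?thesis
    using first g(2) 
    by (intro constant_on_interval[OF S(1) _ S(2,3)])
      (simp add: has_real_derivative_iff_has_vector_derivative)
qed

lemma positive_definite_coercive:
  fixes g :: "'a::euclidean_space \<Rightarrow> 'a \<Rightarrow> real"
  assumes g: "bilinear g" and pos: "\<And>x. x \<noteq> 0 \<Longrightarrow> g x x > 0"
  obtains \<kappa> where "\<kappa> > 0" "\<And>x. \<kappa> * (norm x)\<^sup>2 \<le> g x x"
proof -
  have bb: "bounded_bilinear g" using g by (simp add: bilinear_conv_bounded_bilinear)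
  have "continuous_on (sphere 0 1) (\<lambda>x. g x x)"
    by (intro bounded_bilinear.continuous_on[OF bb] continuous_intros)
  moreover have "sphere (0::'a) 1 \<noteq> {}" by simp
  ultimately obtain e where e: "e \<in> sphere 0 1" and min: "\<And>x. x \<in> sphere 0 1 \<Longrightarrow> g e e \<le> g x x"
    using continuous_attains_inf[of "sphere 0 1" "\<lambda>x. g x x"] by (metis compact_sphere)
  show thesis
  proof (rule that[of "g e e"])
    show "g e e > 0" using e by (intro pos) auto
    fix x :: 'a
    show "g e e * (norm x)\<^sup>2 \<le> g x x"
    proof (cases "x = 0")
      case True
      then show ?thesis using g by (simp add: bilinear_lzero)
    next
      case False
      then have "g e e \<le> g ((1 / norm x) *\<^sub>R x) ((1 / norm x) *\<^sub>R x)" by (intro min) simp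
      also have "\<dots> = g x x / (norm x)\<^sup>2"
        using g by (simp add: bilinear_lmul bilinear_rmul power2_eq_square)
      finally show ?thesis using False by (simp add: field_simps)
    qed
  qed
qed

text \<open>Projecting the argument radially to a ball makes the field bounded and Lipschitz without
  destroying the first integral, so that no a priori continuation argument is needed.\<close>

lemma quadratic_flow_global_solution:
  fixes \<beta> :: "'a::euclidean_space \<Rightarrow> 'a \<Rightarrow> 'a" and g :: "'a \<Rightarrow> 'a \<Rightarrow> real"
  assumes \<beta>: "bilinear \<beta>" and g: "bilinear g" "\<And>x y. g x y = g y x"
    and pos: "\<And>x. x \<noteq> 0 \<Longrightarrow> g x x > 0" and first: "\<And>x. g x (\<beta> x x) = 0"
  shows "\<exists>x. solution_on (\<lambda>x. \<beta> x x) x {0..} \<and> x 0 = a"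
proof -
  obtain \<kappa> where \<kappa>: "\<kappa> > 0" "\<And>x. \<kappa> * (norm x)\<^sup>2 \<le> g x x"
    using positive_definite_coercive[of g] g(1) pos by blast
  obtain B where B: "B > 0" "\<And>x y. norm (\<beta> x y) \<le> B * norm x * norm y"
    using bilinear_bounded[OF \<beta>] by blast
  have gaa: "g a a \<ge> 0" using \<kappa>(2)[of a] \<kappa>(1) by (meson mult_nonneg_nonneg order_trans zero_le_power2 less_imp_le)
  \<comment> \<open>By coercivity the energy level of \<open>a\<close> lies in the ball of radius
    \<open>R\<close>, so a solution of the truncated system never meets the region where the field
    was changed.\<close>
  define R where "R = sqrt (g a a / \<kappa>)"
  have R: "R \<ge> 0" using gaa \<kappa> by (simp add: R_def)
  define \<pi> where "\<pi> = closest_point (cball (0::'a) R)"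
  have \<pi>_in: "norm (\<pi> x) \<le> R" for x
    using closest_point_in_set[of "cball 0 R" x] R by (simp add: \<pi>_def)
  have \<pi>_lip: "norm (\<pi> x - \<pi> y) \<le> norm (x - y)" for x y
    using closest_point_lipschitz[of "cball 0 R" x y] R by (simp add: \<pi>_def dist_norm)
  define f where "f x = \<beta> (\<pi> x) (\<pi> x)" for x
  have "(2 * B * R)-lipschitz_on UNIV f"
  proof (rule lipschitz_onI)
    fix x y
    have "f x - f y = \<beta> (\<pi> x) (\<pi> x - \<pi> y) + \<beta> (\<pi> x - \<pi> y) (\<pi> y)"
      using \<beta> by (simp add: f_def bilinear_lsub bilinear_rsub)
    also have "norm \<dots> \<le> B * R * norm (x - y) + B * norm (x - y) * R"
    proof (intro norm_triangle_mono)
      show "norm (\<beta> (\<pi> x) (\<pi> x - \<pi> y)) \<le> B * R * norm (x - y)"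
        using B(1) R by (intro order_trans[OF B(2)] mult_mono \<pi>_in \<pi>_lip) auto
      show "norm (\<beta> (\<pi> x - \<pi> y) (\<pi> y)) \<le> B * norm (x - y) * R"
        using B(1) R by (intro order_trans[OF B(2)] mult_mono \<pi>_in \<pi>_lip) auto
    qed
    finally show "dist (f x) (f y) \<le> 2 * B * R * dist x y" by (simp add: dist_norm)
  qed (use B R in auto)
  moreover have "bounded (range f)"
    unfolding bounded_iff
  proof (intro exI ballI)
    fix y assume "y \<in> range f"
    then show "norm y \<le> B * R * R"
      using B(1) R \<pi>_in by (auto simp: f_def intro!: order_trans[OF B(2)] mult_mono)
  qed
  ultimately obtain x where x: "solution_on f x {0..}" "x 0 = a"
    using global_solution_exists by blast
  have "g y (f y) = 0" for y
  proof -
    obtain s where "\<pi> y = s *\<^sub>R y" unfolding \<pi>_def using closest_point_cball_0[OF R] by blast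
    then show ?thesis
      using \<beta> g first by (simp add: f_def bilinear_lmul bilinear_rmul)
  qed
  then have "g (x t) (x t) = g a a" if "t \<ge> 0" for t
    using quadratic_first_integral[OF g, of f x "{0..}" t 0] x that by simp
  then have "\<kappa> * (norm (x t))\<^sup>2 \<le> g a a" if "t \<ge> 0" for t
    using \<kappa>(2)[of "x t"] that by simp
  then have "norm (x t) \<le> R" if "t \<ge> 0" for t
    using that \<kappa>(1) unfolding R_def by (intro real_le_rsqrt) (simp add: field_simps)
  then have "\<pi> (x t) = x t" if "t \<ge> 0" for t
    using that by (simp add: \<pi>_def closest_point_self)
  then have "solution_on (\<lambda>x. \<beta> x x) x {0..}"
    using x(1) by (simp add: solution_on_def f_def)
  then show ?thesis using x(2) by blast
qed

section \<open>Lyapunov forms of Hurwitz matrices\<close>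

text \<open>A recursion rather than a product of operators: peeling off the head replaces
  \<open>y\<close> by its image under one factor, which is exactly the induction step for the
  Lyapunov form.\<close>

fun shift_prod :: "(complex^'n \<Rightarrow> complex^'n) \<Rightarrow> complex list \<Rightarrow> complex^'n \<Rightarrow> complex^'n" where
  "shift_prod A [] y = y"
| "shift_prod A (z # zs) y = shift_prod A zs (A y - z *s y)"

text \<open>The inner product on \<open>complex^'n\<close> is the real one, so the imaginary part of
  \<open>z\<close> rotates \<open>y\<close> without changing its length. This is where the sign of
  \<open>Re z\<close> enters.\<close>

lemma inner_vector_scalar_mult_self: "y \<bullet> (z *s y) = Re z * (norm y)\<^sup>2" for y :: "complex^'n"
proof -
  have "y $ i \<bullet> (z * y $ i) = Re z * (y $ i \<bullet> y $ i)" for i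
    by (simp add: inner_complex_def algebra_simps)
  then show ?thesis
    by (simp add: inner_vec_def power2_norm_eq_inner sum_distrib_left)
qed

lemma linear_vector_scalar_mult: "linear (\<lambda>y :: complex^'n. z *s y)"
  by (rule linearI) (auto simp: vec_eq_iff algebra_simps)

text \<open>With \<open>y' = A y\<close>, the iterates \<open>y, (A - z\<^sub>1) y, (A - z\<^sub>2) (A - z\<^sub>1) y, \<dots>\<close> satisfy
  \<open>y\<^sub>j' = z\<^sub>j\<^sub>+\<^sub>1 y\<^sub>j + y\<^sub>j\<^sub>+\<^sub>1\<close>, so a sum of their squared norms with rapidly increasing weights
  decays up to the contribution of the last iterate.\<close>

lemma shift_prod_lyapunov_form:
  fixes A :: "complex^'n \<Rightarrow> complex^'n"
  assumes A: "linear A" "\<And>z y. A (z *s y) = z *s A y"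
    and zs: "\<And>z. z \<in> set zs \<Longrightarrow> Re z < 0"
  shows "\<exists>b \<alpha> C. bilinear b \<and> (\<forall>x y. b x y = (b y x :: real)) \<and> \<alpha> > 0 \<and> C \<ge> 0 \<and> (\<forall>y. b y y \<ge> 0) \<and>
    (\<forall>y. (norm y)\<^sup>2 \<le> b y y + (norm (shift_prod A zs y))\<^sup>2) \<and>
    (\<forall>y. b y (A y) \<le> - \<alpha> * b y y + C * (norm (shift_prod A zs y))\<^sup>2)"
  using zs
proof (induction zs)
  case Nil
  \<comment> \<open>With no factors the last iterate is \<open>y\<close> itself, so the zero form
    satisfies both estimates.\<close>
  show ?case
    by (intro exI[of _ "\<lambda>x y. 0"] exI[of _ 1] exI[of _ 0]) (simp add: bilinear_def linear_zero)
next
  case (Cons z zs)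
  then obtain b \<alpha> C where b: "bilinear b" "\<And>x y. b x y = (b y x :: real)" "\<alpha> > 0" "C \<ge> 0" "\<And>y. b y y \<ge> 0"
    and lower: "\<And>y. (norm y)\<^sup>2 \<le> b y y + (norm (shift_prod A zs y))\<^sup>2"
    and decay: "\<And>y. b y (A y) \<le> - \<alpha> * b y y + C * (norm (shift_prod A zs y))\<^sup>2"
    by auto
  define \<gamma> where "\<gamma> = - Re z"
  have \<gamma>: "\<gamma> > 0" using Cons.prems by (simp add: \<gamma>_def)
  define D where "D y = A y - z *s y" for y
  have D: "linear D"
    unfolding D_def by (intro linear_compose_sub A linear_vector_scalar_mult)
  have D_A: "D (A y) = A (D y)" for y
    using A by (simp add: D_def linear_diff)
  \<comment> \<open>With this weight the coupling term \<open>b (D y) (D y) / (2 * \<gamma>)\<close>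
    left over from Young's inequality is exactly half of the decay
    \<open>K * \<alpha> * b (D y) (D y)\<close>; the other half survives.\<close>
  define K where "K = 1 / (\<alpha> * \<gamma>)"
  have K: "K > 0" using b \<gamma> by (simp add: K_def)
  define b' where "b' x y = x \<bullet> y + K * b (D x) (D y)" for x y
  have "bilinear b'"
    unfolding bilinear_def b'_def
    using b(1) by (auto intro!: linearI simp: linear_add[OF D] linear_scale[OF D] bilinear_ladd
        bilinear_radd bilinear_lmul bilinear_rmul algebra_simps)
  moreover have "b' x y = b' y x" for x y
    using b(2)[of "D x"] by (simp add: b'_def inner_commute)
  moreover have "b' y y \<ge> 0" for y using b K by (simp add: b'_def)
  moreover have "(norm y)\<^sup>2 \<le> b' y y + (norm (shift_prod A (z # zs) y))\<^sup>2" for y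
    using b K by (simp add: b'_def power2_norm_eq_inner)
  moreover have "b' y (A y) \<le> - min (\<gamma> / 2) (\<alpha> / 2) * b' y y +
      (1 / (2 * \<gamma>) + K * C) * (norm (shift_prod A (z # zs) y))\<^sup>2" for y
  proof -
    let ?R = "(norm (shift_prod A zs (D y)))\<^sup>2" and ?m = "min (\<gamma> / 2) (\<alpha> / 2)"
    have Ay: "A y = z *s y + D y" by (simp add: D_def)
    have "0 \<le> (norm (\<gamma> *\<^sub>R y - D y))\<^sup>2" by simp
    also have "\<dots> = \<gamma>\<^sup>2 * (norm y)\<^sup>2 - 2 * \<gamma> * (y \<bullet> D y) + (norm (D y))\<^sup>2"
      unfolding power2_norm_eq_inner by (simp add: inner_diff inner_commute power2_eq_square algebra_simps)
    finally have young: "y \<bullet> D y \<le> \<gamma> / 2 * (norm y)\<^sup>2 + 1 / (2 * \<gamma>) * (norm (D y))\<^sup>2"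
      using \<gamma> by (simp add: field_simps power2_eq_square)
    have "y \<bullet> A y = - \<gamma> * (norm y)\<^sup>2 + y \<bullet> D y"
      by (simp add: Ay inner_add inner_vector_scalar_mult_self \<gamma>_def)
    also have "\<dots> \<le> - \<gamma> / 2 * (norm y)\<^sup>2 + 1 / (2 * \<gamma>) * (norm (D y))\<^sup>2"
      using young by (simp add: field_simps)
    also have "\<dots> \<le> - \<gamma> / 2 * (norm y)\<^sup>2 + 1 / (2 * \<gamma>) * (b (D y) (D y) + ?R)"
      using lower[of "D y"] \<gamma> by (intro add_left_mono mult_left_mono) auto
    finally have 1: "y \<bullet> A y \<le> - \<gamma> / 2 * (norm y)\<^sup>2 + 1 / (2 * \<gamma>) * (b (D y) (D y) + ?R)" .
    have 2: "K * b (D y) (D (A y)) \<le> K * (- \<alpha> * b (D y) (D y) + C * ?R)"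
      unfolding D_A using K decay by (intro mult_left_mono) auto
    have "K * \<alpha> = 1 / \<gamma>" using b by (simp add: K_def)
    then have 3: "K * (- \<alpha> * b (D y) (D y) + C * ?R) + 1 / (2 * \<gamma>) * (b (D y) (D y) + ?R)
        = - (\<alpha> / 2) * (K * b (D y) (D y)) + (1 / (2 * \<gamma>) + K * C) * ?R"
      using \<gamma> b by (simp add: K_def field_simps)
    have "?m * (norm y)\<^sup>2 \<le> \<gamma> / 2 * (norm y)\<^sup>2" "?m * (K * b (D y) (D y)) \<le> \<alpha> / 2 * (K * b (D y) (D y))"
      using K b by (intro mult_right_mono; simp)+
    then have "- (\<gamma> / 2) * (norm y)\<^sup>2 - (\<alpha> / 2) * (K * b (D y) (D y)) \<le> - ?m * b' y y"
      by (simp add: b'_def power2_norm_eq_inner algebra_simps)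
    moreover have "b' y (A y) = y \<bullet> A y + K * b (D y) (D (A y))" by (simp add: b'_def)
    ultimately have "b' y (A y) \<le> - ?m * b' y y + (1 / (2 * \<gamma>) + K * C) * ?R"
      using 1 2 3 by linarith
    then show ?thesis by (simp add: D_def)
  qed
  ultimately show ?case
    using \<gamma> b K by (intro exI[of _ b'] exI[of _ "min (\<gamma> / 2) (\<alpha> / 2)"] exI[of _ "1 / (2 * \<gamma>) + K * C"]) auto
qed

section \<open>Annihilating polynomials of a complex matrix\<close>

definition poly_op :: "complex poly \<Rightarrow> (complex^'n \<Rightarrow> complex^'n) \<Rightarrow> complex^'n \<Rightarrow> complex^'n" where
  "poly_op q A y = (\<Sum>i\<le>degree q. coeff q i *s (A ^^ i) y)"

lemma poly_op_eq: "degree q \<le> n \<Longrightarrow> poly_op q A y = (\<Sum>i\<le>n. coeff q i *s (A ^^ i) y)"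
  unfolding poly_op_def by (rule sum.mono_neutral_left) (auto simp: coeff_eq_0)

lemma linear_funpow: "linear f \<Longrightarrow> linear (f ^^ i)" for f :: "'a::real_vector \<Rightarrow> 'a"
  by (induction i) (auto simp: linear_id[unfolded id_def] intro: linear_compose linear_id)

text \<open>Both orders of the factors are needed: the linear factor applied first matches
  \<open>shift_prod\<close>, and applied last it exhibits eigenvectors.\<close>

lemma poly_op_shift:
  fixes A :: "complex^'n \<Rightarrow> complex^'n"
  assumes A: "linear A" "\<And>z y. A (z *s y) = z *s A y"
  shows "poly_op ([:-z, 1:] * r) A y = poly_op r A (A y - z *s y)"
    and "poly_op ([:-z, 1:] * r) A y = A (poly_op r A y) - z *s poly_op r A y"
proof -
  have lin: "linear (A ^^ i)" for i using A(1) by (rule linear_funpow)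
  have scale: "(A ^^ i) (z *s y) = z *s (A ^^ i) y" for i z y
    by (induction i) (auto simp: A)
  have deg: "degree ([:-z, 1:] * r) \<le> Suc (degree r)"
    by (rule order_trans[OF degree_mult_le]) simp
  have co: "coeff ([:-z, 1:] * r) i = (case i of 0 \<Rightarrow> 0 | Suc j \<Rightarrow> coeff r j) - z * coeff r i" for i
    by (simp add: coeff_pCons)
  have "poly_op ([:-z, 1:] * r) A y =
      (\<Sum>i\<le>Suc (degree r). (case i of 0 \<Rightarrow> 0 | Suc j \<Rightarrow> coeff r j) *s (A ^^ i) y)
      - (\<Sum>i\<le>Suc (degree r). (z * coeff r i) *s (A ^^ i) y)"
    unfolding poly_op_eq[OF deg] co
    by (simp add: vector_sub_rdistrib sum_subtractf del: sum.atMost_Suc)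
  also have "(\<Sum>i\<le>Suc (degree r). (case i of 0 \<Rightarrow> 0 | Suc j \<Rightarrow> coeff r j) *s (A ^^ i) y)
      = (\<Sum>i\<le>degree r. coeff r i *s (A ^^ i) (A y))"
    by (subst sum.atMost_Suc_shift) (simp add: funpow_swap1)
  also have "(\<Sum>i\<le>Suc (degree r). (z * coeff r i) *s (A ^^ i) y)
      = (\<Sum>i\<le>degree r. coeff r i *s (A ^^ i) (z *s y))"
    by (simp add: coeff_eq_0 scale vector_smult_assoc mult.commute)
  finally have *: "poly_op ([:-z, 1:] * r) A y = (\<Sum>i\<le>degree r. coeff r i *s (A ^^ i) (A y)) -
      (\<Sum>i\<le>degree r. coeff r i *s (A ^^ i) (z *s y))" .
  then show "poly_op ([:-z, 1:] * r) A y = poly_op r A (A y - z *s y)"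
    by (simp add: poly_op_def linear_diff[OF lin] vector_ssub_ldistrib sum_subtractf)
  show "poly_op ([:-z, 1:] * r) A y = A (poly_op r A y) - z *s poly_op r A y"
    unfolding * unfolding poly_op_def linear_sum[OF A(1)] linear_sum[OF linear_vector_scalar_mult] A(2) scale
    by (simp add: funpow_swap1 vector_smult_assoc mult.commute)
qed

lemma poly_op_prod_list:
  fixes A :: "complex^'n \<Rightarrow> complex^'n"
  assumes A: "linear A" "\<And>z y. A (z *s y) = z *s A y"
  shows "poly_op (\<Prod>z\<leftarrow>zs. [:-z, 1:]) A y = shift_prod A zs y"
proof (induction zs arbitrary: y)
  case Nil
  then show ?case by (simp add: poly_op_def)
next
  case (Cons z zs)
  then show ?case by (simp only: list.map prod_list.Cons poly_op_shift(1)[OF A] shift_prod.simps)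
qed

text \<open>Stated for an indexed family since powers of a matrix may coincide; a repetition gives a
  relation directly, otherwise the image is too large to be independent.\<close>

lemma nontrivial_linear_relation:
  fixes f :: "nat \<Rightarrow> 'a::euclidean_space"
  shows "\<exists>u. (\<exists>i\<le>DIM('a). u i \<noteq> 0) \<and> (\<Sum>i\<le>DIM('a). u i *\<^sub>R f i) = 0"
proof (cases "inj_on f {..DIM('a)}")
  case True
  let ?S = "f ` {..DIM('a)}"
  have "card ?S = Suc (DIM('a))" using True by (simp add: card_image)
  then have "dependent ?S" by (intro dependent_biggerset) simp
  then obtain u where u: "(\<Sum>v\<in>?S. u v *\<^sub>R v) = 0" "\<exists>v\<in>?S. u v \<noteq> 0"
    by (auto simp: dependent_finite)
  then show ?thesis
    using True by (intro exI[of _ "u \<circ> f"]) (auto simp: sum.reindex)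
next
  case False
  then obtain i j where ij: "i \<le> DIM('a)" "j \<le> DIM('a)" "i \<noteq> j" "f i = f j"
    by (auto simp: inj_on_def)
  define u where "u k = (if k = i then 1 else 0) - (if k = j then 1 else (0::real))" for k
  have "(\<Sum>k\<le>DIM('a). u k *\<^sub>R f k) = (\<Sum>k\<le>DIM('a). if k = i then f k else 0) - (\<Sum>k\<le>DIM('a). if k = j then f k else 0)"
    unfolding sum_subtractf[symmetric] by (rule sum.cong) (auto simp: u_def)
  also have "\<dots> = 0" using ij by simp
  finally show ?thesis using ij by (intro exI[of _ u] conjI exI[of _ i]) (auto simp: u_def)
qed

text \<open>The powers of \<open>M\<close> up to \<open>d\<close>, the real dimension of the matrix
  space, are linearly dependent over the reals; the coefficients of the relation are those of
  \<open>q\<close>.\<close>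

lemma annihilating_poly_exists:
  fixes M :: "complex^'n^'n"
  shows "\<exists>q. q \<noteq> 0 \<and> (\<forall>y. poly_op q ((*v) M) y = 0)"
proof -
  define d where "d = DIM(complex^'n^'n)"
  define f where "f i = ((**) M ^^ i) (mat 1)" for i
  have f: "f i *v y = (((*v) M) ^^ i) y" for i y
    by (induction i) (auto simp: f_def matrix_vector_mul_assoc[symmetric])
  obtain u where u: "\<exists>i\<le>d. u i \<noteq> 0" "(\<Sum>i\<le>d. u i *\<^sub>R f i) = 0"
    using nontrivial_linear_relation[of f] by (auto simp: d_def)
  define q where "q = (\<Sum>i\<le>d. monom (complex_of_real (u i)) i)"
  have co: "coeff q i = (if i \<le> d then of_real (u i) else 0)" for i
    by (simp add: q_def coeff_sum if_distrib[where f = "\<lambda>x. x * _"] cong: if_cong)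
  have "q \<noteq> 0" using u(1) co by (metis coeff_0 of_real_eq_0_iff)
  moreover have "poly_op q ((*v) M) y = 0" for y
  proof -
    have "degree q \<le> d" by (intro degree_le) (simp add: co)
    then have "poly_op q ((*v) M) y = (\<Sum>i\<le>d. of_real (u i) *s (f i *v y))"
      by (simp add: poly_op_eq co f)
    also have "\<dots> = (\<Sum>i\<le>d. u i *\<^sub>R f i) *v y"
      by (simp add: vec_eq_iff matrix_vector_mult_def sum_distrib_left sum_distrib_right
          sum.swap[where A = "{..d}"] mult.assoc scaleR_conv_of_real[where 'a = complex])
    finally show ?thesis using u(2) by simp
  qed
  ultimately show ?thesis by blast
qed

text \<open>Minimal degree ensures that every listed root is an eigenvalue: if \<open>q\<close> is
  \<open>X - z\<close> times \<open>r\<close>, minimality yields \<open>y\<close> with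
  \<open>r(M) y\<close> nonzero, and \<open>M - z\<close> kills that vector. Otherwise spurious
  roots could lie in the right half-plane.\<close>

lemma annihilating_eigenvalue_list:
  fixes M :: "complex^'n^'n"
  shows "\<exists>zs. (\<forall>y. shift_prod ((*v) M) zs y = 0) \<and> (\<forall>z\<in>set zs. \<exists>y. y \<noteq> 0 \<and> M *v y = z *s y)"
proof -
  let ?P = "\<lambda>q. q \<noteq> 0 \<and> (\<forall>y. poly_op q ((*v) M) y = 0)"
  have lin: "linear ((*v) M)" "\<And>z y. M *v (z *s y) = z *s (M *v y)"
    by (auto intro!: linearI simp: vec_eq_iff matrix_vector_mult_def algebra_simps
        sum.distrib scaleR_right.sum sum_distrib_left)
  obtain q where q: "?P q" and least: "\<And>r. degree r < degree q \<Longrightarrow> \<not> ?P r"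
    using annihilating_poly_exists[of M] exists_least_iff[of "\<lambda>n. \<exists>q. degree q = n \<and> ?P q"]
    by (metis (no_types, lifting))
  obtain zs where zs: "q = smult (lead_coeff q) (\<Prod>z\<leftarrow>zs. [:-z, 1:])"
    using alg_closed_imp_factorization[of q] q ex_mset
    by (metis prod_mset_prod_list mset_map)
  have "shift_prod ((*v) M) zs y = 0" for y
  proof -
    have "0 = poly_op q ((*v) M) y" using q by simp
    also have "\<dots> = lead_coeff q *s poly_op (\<Prod>z\<leftarrow>zs. [:-z, 1:]) ((*v) M) y"
      by (subst zs) (use q in \<open>simp add: poly_op_def linear_sum[OF linear_vector_scalar_mult] vector_smult_assoc\<close>)
    finally show ?thesis
      using q by (auto simp: poly_op_prod_list[OF lin] vec_eq_iff)
  qed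
  moreover have "\<exists>y. y \<noteq> 0 \<and> M *v y = z *s y" if "z \<in> set zs" for z
  proof -
    have "poly (\<Prod>z\<leftarrow>zs. [:-z, 1:]) z = 0"
      using that by (induction zs) auto
    then have "poly q z = 0" by (subst zs) simp
    then obtain r where r: "q = [:-z, 1:] * r" by (auto simp: poly_eq_0_iff_dvd)
    with q have "r \<noteq> 0" by auto
    then have "degree r < degree q" unfolding r by (subst degree_mult_eq) auto
    then obtain y where y: "poly_op r ((*v) M) y \<noteq> 0" using least \<open>r \<noteq> 0\<close> by blast
    have "0 = M *v poly_op r ((*v) M) y - z *s poly_op r ((*v) M) y"
      using q poly_op_shift(2)[OF lin, of z r y] by (simp only: r)
    then show ?thesis using y by auto
  qed
  ultimately show ?thesis by blast
qed

section \<open>Roots of the characteristic polynomial and the form for a Hurwitz matrix\<close>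

lemma poly_charpoly: "poly (charpoly A) z = det (mat z - (\<chi> i j. complex_of_real (A $ i $ j)))"
  unfolding charpoly_def det_def
  by (auto simp: poly_sum poly_prod mat_def of_int_poly intro!: sum.cong prod.cong)

lemma det_eq_0_iff_kernel: "det A = 0 \<longleftrightarrow> (\<exists>x. x \<noteq> 0 \<and> A *v x = 0)" for A :: "'a::field^'n^'n"
  using invertible_det_nz[of A] invertible_left_inverse[of A] matrix_left_invertible_ker[of A] by auto

lemma charpoly_root_iff:
  "poly (charpoly A) z = 0 \<longleftrightarrow> (\<exists>x. x \<noteq> 0 \<and> (\<chi> i j. complex_of_real (A $ i $ j)) *v x = z *s x)"
proof -
  have "(mat z :: complex^'a^'a) *v x = z *s x" for x
    by (simp add: vec_eq_iff matrix_vector_mult_def mat_def if_distrib[where f = "\<lambda>x. x * _"] cong: if_cong)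
  then show ?thesis
    by (auto simp: poly_charpoly det_eq_0_iff_kernel matrix_vector_mult_diff_rdistrib)
qed

text \<open>Along an annihilating list the last iterate vanishes, so the error terms of
  \<open>shift_prod_lyapunov_form\<close> disappear. The complex form is pulled back along the
  isometric embedding \<open>\<iota>\<close>, which intertwines \<open>M\<close> with its
  complexification.\<close>

lemma hurwitz_lyapunov_form:
  fixes M :: "real^'n^'n"
  assumes hurwitz: "\<And>z. poly (charpoly M) z = 0 \<Longrightarrow> Re z < 0"
  shows "\<exists>b \<alpha>. bilinear b \<and> (\<forall>x y. b x y = (b y x :: real)) \<and> \<alpha> > 0 \<and>
    (\<forall>y. (norm y)\<^sup>2 \<le> b y y) \<and> (\<forall>y. b y (M *v y) \<le> - \<alpha> * b y y)"
proof -
  define Mc :: "complex^'n^'n" where "Mc = (\<chi> i j. of_real (M $ i $ j))"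
  define \<iota> :: "real^'n \<Rightarrow> complex^'n" where "\<iota> x = (\<chi> i. of_real (x $ i))" for x
  have \<iota>: "linear \<iota>" by (rule linearI) (auto simp: \<iota>_def vec_eq_iff scaleR_conv_of_real[where 'a = complex])
  have norm_\<iota>: "norm (\<iota> x) = norm x" for x by (simp add: \<iota>_def norm_vec_def)
  have \<iota>_M: "\<iota> (M *v x) = Mc *v \<iota> x" for x
    by (simp add: \<iota>_def Mc_def matrix_vector_mult_def vec_eq_iff)
  have lin: "linear ((*v) Mc)" "\<And>z y. Mc *v (z *s y) = z *s (Mc *v y)"
    by (auto intro!: linearI simp: vec_eq_iff matrix_vector_mult_def algebra_simps
        sum.distrib scaleR_right.sum sum_distrib_left)
  obtain zs where zs: "\<And>y. shift_prod ((*v) Mc) zs y = 0"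
    and ev: "\<And>z. z \<in> set zs \<Longrightarrow> \<exists>y. y \<noteq> 0 \<and> Mc *v y = z *s y"
    using annihilating_eigenvalue_list[of Mc] by blast
  have "Re z < 0" if "z \<in> set zs" for z
    using ev[OF that] hurwitz[of z] by (simp add: charpoly_root_iff Mc_def)
  then obtain b \<alpha> C where b: "bilinear b" "\<And>x y. b x y = (b y x :: real)" "\<alpha> > 0"
    "\<And>y. (norm y)\<^sup>2 \<le> b y y" "\<And>y. b y (Mc *v y) \<le> - \<alpha> * b y y"
    using shift_prod_lyapunov_form[OF lin, of zs] unfolding zs by auto
  have "bilinear (\<lambda>x y. b (\<iota> x) (\<iota> y))"
    unfolding bilinear_def
    using b(1) by (auto intro!: linearI simp: linear_add[OF \<iota>] linear_scale[OF \<iota>] bilinear_ladd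
        bilinear_radd bilinear_lmul bilinear_rmul)
  then show ?thesis
    using b by (intro exI[of _ "\<lambda>x y. b (\<iota> x) (\<iota> y)"] exI[of _ \<alpha>])
      (simp add: \<iota>_M flip: norm_\<iota>)
qed

section \<open>Removing a simple eigenvalue zero\<close>

lemma degree_charpoly_le: "degree (charpoly (A :: real^'n^'n)) \<le> CARD('n)"
  unfolding charpoly_def det_def
proof (intro degree_sum_le)
  fix p :: "'n \<Rightarrow> 'n" assume "p \<in> {p. p permutes UNIV}"
  let ?f = "\<lambda>i. (\<chi> i j. (if i = j then [:0, 1:] else 0) - [:complex_of_real (A $ i $ j):]) $ i $ p i"
  have "degree (\<Prod>i\<in>UNIV. ?f i) \<le> (\<Sum>i\<in>UNIV. degree (?f i))"
    using degree_prod_sum_le[of UNIV ?f] by (simp add: o_def)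
  also have "\<dots> \<le> (\<Sum>i\<in>(UNIV :: 'n set). 1)"
    by (intro sum_mono) auto
  finally have "degree (\<Prod>i\<in>UNIV. ?f i) \<le> CARD('n)" by simp
  then show "degree (of_int (sign p) * (\<Prod>i\<in>UNIV. ?f i)) \<le> CARD('n)"
    using degree_mult_le[of "of_int (sign p)" "\<Prod>i\<in>UNIV. ?f i"] by simp
qed simp

lemma sum_of_real_mult:
  "(\<Sum>k\<in>K. complex_of_real (f k) * complex_of_real (g k)) = of_real (\<Sum>k\<in>K. f k * g k)"
  by simp

text \<open>If \<open>A B = 0\<close> then \<open>(z - A) (z - B) = z (z - (A + B))\<close>; take
  determinants.\<close>

lemma charpoly_mult_of_product_zero:
  fixes A B :: "real^'n^'n"
  assumes "A ** B = 0"
  shows "charpoly A * charpoly B = [:0, 1:] ^ CARD('n) * charpoly (A + B)"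
proof (rule poly_eq_poly_eq_iff[THEN iffD1, OF ext])
  fix z
  let ?c = "\<lambda>A :: real^'n^'n. \<chi> i j. complex_of_real (A $ i $ j)"
  have "(\<Sum>k\<in>UNIV. complex_of_real (A $ i $ k) * of_real (B $ k $ j)) = 0" for i j
  proof -
    have "(\<Sum>k\<in>UNIV. A $ i $ k * B $ k $ j) = 0"
      using assms by (simp add: vec_eq_iff matrix_matrix_mult_def)
    then show ?thesis by (simp only: sum_of_real_mult of_real_0)
  qed
  then have "(mat z - ?c A) ** (mat z - ?c B) = mat z ** (mat z - ?c (A + B))"
    by (simp add: vec_eq_iff matrix_matrix_mult_def mat_def ring_distribs sum_subtractf sum.distrib
        if_distrib[where f = "\<lambda>x. x * _"] if_distrib[where f = "\<lambda>x. _ * x"] mult.commute cong: if_cong)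
  then have "det (mat z - ?c A) * det (mat z - ?c B) = det (mat z :: complex^'n^'n) * det (mat z - ?c (A + B))"
    by (metis det_mul)
  also have "det (mat z :: complex^'n^'n) = z ^ CARD('n)"
    using det_diagonal[of "mat z :: complex^'n^'n"] by (simp add: mat_def)
  finally show "poly (charpoly A * charpoly B) z = poly ([:0, 1:] ^ CARD('n) * charpoly (A + B)) z"
    by (simp add: poly_charpoly)
qed

text \<open>The rank one correction moves the eigenvalue \<open>0\<close> of \<open>A\<close> to \<open>-1\<close>; the identity
  \<open>\<chi>\<^sub>A \<chi>\<^sub>B = z\<^sup>n \<chi>\<^sub>A\<^sub>+\<^sub>B\<close> controls the order of the root \<open>0\<close> and hence rules out a further
  vector in the kernel.\<close>

lemma hurwitz_deflation:
  fixes A B :: "real^'n^'n" and a l :: "real^'n"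
  assumes size: "size {# z \<in># proots (charpoly A). Re z < 0 #} = CARD('n) - 1" and card: "CARD('n) \<ge> 2"
    and a: "A *v a = 0" and la: "l \<bullet> a = 1"
    and B: "B = (\<chi> i j. - (a $ i * l $ j))"
    and root: "poly (charpoly (A + B)) z = 0"
  shows "Re z < 0"
proof (rule ccontr)
  assume z: "\<not> Re z < 0"
  let ?n = "CARD('n)"
  have "a \<noteq> 0" using la by auto
  define ca :: "complex^'n" where "ca = (\<chi> i. of_real (a $ i))"
  have ca: "ca \<noteq> 0" using \<open>a \<noteq> 0\<close> by (auto simp: ca_def vec_eq_iff)
  have lca: "(\<Sum>j\<in>UNIV. of_real (l $ j) * ca $ j) = 1"
  proof -
    have "(\<Sum>j\<in>UNIV. complex_of_real (l $ j) * ca $ j) = of_real (l \<bullet> a)"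
      by (simp add: ca_def inner_vec_def)
    then show ?thesis by (simp add: la)
  qed
  \<comment> \<open>Every column of \<open>B\<close> is a multiple of \<open>a\<close>, hence lies
    in the kernel of \<open>A\<close>.\<close>
  have "A ** B = 0"
  proof -
    have "(\<Sum>k\<in>UNIV. A $ i $ k * a $ k) = 0" for i
      using a by (simp add: vec_eq_iff matrix_vector_mult_def)
    then have "(\<Sum>k\<in>UNIV. A $ i $ k * - (a $ k * l $ j)) = 0" for i j
      by (simp add: sum_negf mult.assoc[symmetric] flip: sum_distrib_right)
    then show ?thesis by (simp add: B vec_eq_iff matrix_matrix_mult_def)
  qed
  then have prod: "charpoly A * charpoly B = [:0, 1:] ^ ?n * charpoly (A + B)"
    by (rule charpoly_mult_of_product_zero)
  have Bx: "(\<chi> i j. complex_of_real (B $ i $ j)) *v x = - (\<Sum>j\<in>UNIV. of_real (l $ j) * x $ j) *s ca" for x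
    by (simp add: B ca_def vec_eq_iff matrix_vector_mult_def sum_negf sum_distrib_right sum_distrib_left mult_ac)
  have B_roots: "w = 0 \<or> w = -1" if "poly (charpoly B) w = 0" for w
  proof -
    obtain x where x: "x \<noteq> 0" "- (\<Sum>j\<in>UNIV. of_real (l $ j) * x $ j) *s ca = w *s x"
      using \<open>poly (charpoly B) w = 0\<close> unfolding charpoly_root_iff Bx by blast
    define s where "s = (\<Sum>j\<in>UNIV. of_real (l $ j) * x $ j)"
    have sx: "- s * ca $ j = w * x $ j" for j
      using x(2) by (simp add: s_def[symmetric] vec_eq_iff)
    have "w * s = (\<Sum>j\<in>UNIV. of_real (l $ j) * (w * x $ j))"
      by (simp add: s_def sum_distrib_left mult_ac)
    also have "\<dots> = - s * (\<Sum>j\<in>UNIV. of_real (l $ j) * ca $ j)"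
      unfolding sx[symmetric] by (simp add: sum_distrib_left sum_negf mult_ac)
    finally have "w * s = - s" unfolding lca by simp
    then have "(w + 1) * s = 0" by (simp add: distrib_right)
    moreover have "w = 0" if "s = 0"
      using sx x(1) that by (auto simp: vec_eq_iff)
    ultimately show ?thesis by (auto simp: eq_neg_iff_add_eq_0)
  qed
  have B0: "charpoly B \<noteq> 0" using B_roots[of 1] by auto
  \<comment> \<open>This root occupies one of at most \<open>?n\<close> places, so the order of 0 in
    \<open>charpoly B\<close> is below \<open>?n\<close>. A root 0 of
    \<open>charpoly (A + B)\<close> would push it to \<open>?n\<close> at least.\<close>
  have "poly (charpoly B) (-1) = 0"
    unfolding charpoly_root_iff Bx by (intro exI[of _ ca]) (use ca lca in \<open>simp add: vec_eq_iff\<close>)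
  then have "-1 \<in># proots (charpoly B)" using B0 by simp
  then obtain N where N: "proots (charpoly B) = add_mset (-1) N" by (meson mset_add)
  have "order 0 (charpoly B) = count N 0" using B0 N by (simp flip: count_proots)
  also have "\<dots> \<le> size N" by (rule count_le_size)
  also have "Suc (size N) \<le> ?n"
    using size_proots_le[of "charpoly B"] degree_charpoly_le[of B] N by simp
  finally have order_B: "order 0 (charpoly B) < ?n" by simp
  \<comment> \<open>The multiset \<open>proots 0\<close> is empty by convention, which would
    contradict the positive count \<open>?n - 1\<close>.\<close>
  have A0: "charpoly A \<noteq> 0" using size card by auto
  \<comment> \<open>With \<open>?n - 1\<close> roots on the left and degree at most
    \<open>?n\<close>, there is room for one more, and the kernel vector puts 0 there. So 0 is a
    simple root and the only one outside the left half-plane.\<close>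
  let ?M = "{# z \<in># proots (charpoly A). \<not> Re z < 0 #}"
  have "size (proots (charpoly A)) = (?n - 1) + size ?M"
    unfolding size[symmetric] by (metis multiset_partition size_union)
  then have "size ?M \<le> 1"
    using size_proots_le[of "charpoly A"] degree_charpoly_le[of A] card by simp
  moreover have "0 \<in># ?M"
  proof -
    have "(\<chi> i j. complex_of_real (A $ i $ j)) *v ca = 0"
    proof -
      have "(\<Sum>k\<in>UNIV. A $ i $ k * a $ k) = 0" for i
        using a by (simp add: vec_eq_iff matrix_vector_mult_def)
      then have "(\<Sum>k\<in>UNIV. complex_of_real (A $ i $ k) * of_real (a $ k)) = 0" for i
        by (simp only: sum_of_real_mult of_real_0)
      then show ?thesis by (simp add: ca_def vec_eq_iff matrix_vector_mult_def)
    qed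
    then have "poly (charpoly A) 0 = 0"
      unfolding charpoly_root_iff by (intro exI[of _ ca]) (simp add: ca)
    then show ?thesis using A0 by simp
  qed
  ultimately have M: "?M = {#0#}"
    by (elim mset_add[of 0 ?M]) simp
  have "count (proots (charpoly A)) 0 = count ?M 0" by simp
  then have order_A: "order 0 (charpoly A) = 1" using A0 M by simp
  have A_roots: "w = 0" if "poly (charpoly A) w = 0" "\<not> Re w < 0" for w
  proof -
    have "w \<in># ?M" using that A0 by simp
    then show ?thesis by (simp add: M)
  qed
  show False
  proof (cases "z = 0")
    case True
    have ne: "charpoly A * charpoly B \<noteq> 0" using A0 B0 by simp
    then have ne': "charpoly (A + B) \<noteq> 0" unfolding prod by auto
    have "1 + order 0 (charpoly B) = order 0 (charpoly A * charpoly B)"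
      using ne order_A by (simp add: order_mult)
    also have "\<dots> = order 0 ([:0, 1 :: complex:] ^ ?n) + order 0 (charpoly (A + B))"
      using ne unfolding prod by (rule order_mult)
    also have "order 0 ([:0, 1 :: complex:] ^ ?n) = ?n"
      using order_power_n_n[of "0 :: complex" ?n] by simp
    finally have "1 + order 0 (charpoly B) = ?n + order 0 (charpoly (A + B))" .
    moreover have "order 0 (charpoly (A + B)) > 0"
      using root True ne' by (simp add: order_root)
    ultimately show False using order_B by linarith
  next
    case False
    have "poly (charpoly A * charpoly B) z = 0" unfolding prod using root by simp
    then have "poly (charpoly B) z = 0" using A_roots z False by auto
    then show False using B_roots[of z] z False by auto
  qed
qed

section \<open>Dynamics near a line of steady motions\<close>

text \<open>The product \<open>f s * exp (k * s)\<close> has nonpositive derivative. Both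
  \<open>f\<close> and \<open>k\<close> may be negative, so exponential growth is obtained by
  applying this to \<open>- V\<close> with a negative rate.\<close>

lemma exponential_decay_bound:
  fixes f :: "real \<Rightarrow> real"
  assumes "t \<ge> 0"
    and deriv: "\<And>s. 0 \<le> s \<Longrightarrow> s \<le> t \<Longrightarrow> (f has_real_derivative f' s) (at s within {0..t})"
    and le: "\<And>s. 0 \<le> s \<Longrightarrow> s \<le> t \<Longrightarrow> f' s \<le> - k * f s"
  shows "f t \<le> f 0 * exp (- k * t)"
proof (cases "t = 0")
  case False
  then have "0 < t" using \<open>t \<ge> 0\<close> by simp
  let ?h = "\<lambda>s. f s * exp (k * s)"
  have "(?h has_real_derivative (f' s + k * f s) * exp (k * s)) (at s within {0..t})"
    if "0 \<le> s" "s \<le> t" for s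
    by (auto intro!: derivative_eq_intros deriv that simp: algebra_simps)
  then obtain s where s: "s \<in> {0<..<t}" "?h t - ?h 0 = (f' s + k * f s) * exp (k * s) * (t - 0)"
    using mvt_simple[OF \<open>0 < t\<close>, of ?h "\<lambda>s. (*) ((f' s + k * f s) * exp (k * s))"]
    by (auto simp: has_field_derivative_def)
  have "(f' s + k * f s) * exp (k * s) * (t - 0) \<le> 0"
    using le[of s] s(1) by (intro mult_nonpos_nonneg) auto
  then have "?h t \<le> f 0" using s(2) by simp
  then show ?thesis by (simp add: exp_minus field_simps)
qed simp

lemma continuous_small_near_zero:
  fixes f :: "'a::metric_space \<Rightarrow> real"
  assumes "continuous_on UNIV f" "f a = 0" "e > 0"
  obtains \<delta> where "\<delta> > 0" "\<And>y. dist y a < \<delta> \<Longrightarrow> \<bar>f y\<bar> < e"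
proof -
  obtain \<delta> where \<delta>: "\<delta> > 0" "\<forall>y\<in>UNIV. dist y a < \<delta> \<longrightarrow> dist (f y) (f a) < e"
    using assms(1)[unfolded continuous_on_iff, rule_format, OF UNIV_I assms(3), of a] by blast
  show thesis by (rule that[OF \<delta>(1)]) (use \<delta>(2) assms(2) in simp)
qed

text \<open>Bootstrap: at the first time \<open>h\<close> reaches \<open>\<rho>\<close>, the weak
  bound holds up to that time, and \<open>step\<close> upgrades it to a strict one, a
  contradiction.\<close>

lemma trapped_below_level:
  fixes h :: "real \<Rightarrow> real"
  assumes "t \<ge> 0" and cont: "continuous_on {0..t} h" and "h 0 < \<rho>"
    and step: "\<And>s. 0 \<le> s \<Longrightarrow> s \<le> t \<Longrightarrow> (\<And>u. 0 \<le> u \<Longrightarrow> u \<le> s \<Longrightarrow> h u \<le> \<rho>) \<Longrightarrow> h s < \<rho>"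
  shows "h t < \<rho>"
proof (rule ccontr)
  assume "\<not> h t < \<rho>"
  define E where "E = {s \<in> {0..t}. h s = \<rho>}"
  have reach: "\<exists>u\<in>E. u \<le> s" if "0 \<le> s" "s \<le> t" "h s \<ge> \<rho>" for s
    using IVT'[of h 0 \<rho> s] continuous_on_subset[OF cont, of "{0..s}"] that \<open>h 0 < \<rho>\<close>
    by (force simp: E_def)
  have "closed E" unfolding E_def
    by (rule continuous_closed_preimage_constant[OF cont]) simp
  moreover have "E \<noteq> {}" using reach[of t] \<open>\<not> h t < \<rho>\<close> \<open>t \<ge> 0\<close> by auto
  moreover have "bdd_below E" by (auto simp: E_def bdd_below_def)
  ultimately have inf: "Inf E \<in> E" by (intro closed_contains_Inf)
  have "h u \<le> \<rho>" if u: "0 \<le> u" "u \<le> Inf E" for u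
  proof (rule ccontr)
    assume "\<not> h u \<le> \<rho>"
    moreover have "u \<le> t" using u inf by (auto simp: E_def)
    ultimately obtain u' where u': "u' \<in> E" "u' \<le> u" using reach[of u] u by auto
    then have "u' = u" using cInf_lower[OF u'(1) \<open>bdd_below E\<close>] u by simp
    then show False using u' \<open>\<not> h u \<le> \<rho>\<close> by (simp add: E_def)
  qed
  then have "h (Inf E) < \<rho>" using inf by (intro step) (auto simp: E_def)
  then show False using inf by (simp add: E_def)
qed

lemma continuous_on_bilinear:
  fixes h :: "'a::euclidean_space \<Rightarrow> 'b::euclidean_space \<Rightarrow> 'c::real_normed_vector"
  assumes "bilinear h" "continuous_on S f" "continuous_on S k"
  shows "continuous_on S (\<lambda>x. h (f x) (k x))"
  using bounded_bilinear.continuous_on[OF _ assms(2,3)] assms(1)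
  by (simp add: bilinear_conv_bounded_bilinear)

lemma convex_interval_subset: "convex S \<Longrightarrow> s \<in> S \<Longrightarrow> t \<in> S \<Longrightarrow> {s..t} \<subseteq> S" for S :: "real set"
  by (meson atLeastAtMost_iff is_interval_1 is_interval_convex_1 subsetI)

lemma solution_on_subset: "solution_on v x S \<Longrightarrow> T \<subseteq> S \<Longrightarrow> solution_on v x T"
  unfolding solution_on_def by (blast intro: has_vector_derivative_within_subset)

text \<open>\<open>g\<close> is the polarised energy, \<open>x \<mapsto> \<beta> x x\<close> the vector field, \<open>a\<close> the steady motion,
  and \<open>b\<close> a Lyapunov form for the linearization at \<open>a\<close> on the \<open>g\<close>-orthogonal complement of
  \<open>a\<close>.\<close>

locale attracting_steady_line =
  fixes \<beta> :: "'a::euclidean_space \<Rightarrow> 'a \<Rightarrow> 'a" and g :: "'a \<Rightarrow> 'a \<Rightarrow> real" and a :: 'a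
    and b :: "'a \<Rightarrow> 'a \<Rightarrow> real" and \<alpha> :: real
  assumes \<beta>: "bilinear \<beta>"
    and g: "bilinear g" and g_sym: "g x y = g y x" and g_pos: "x \<noteq> 0 \<Longrightarrow> g x x > 0"
    and first_integral: "g x (\<beta> x x) = 0"
    and a_nonzero: "a \<noteq> 0" and steady: "\<beta> a a = 0"
    and b: "bilinear b" and b_sym: "b x y = b y x" and b_lower: "(norm x)\<^sup>2 \<le> b x x"
    and \<alpha>: "\<alpha> > 0"
    and decay: "g a y = 0 \<Longrightarrow> b y (\<beta> a y + \<beta> y a) \<le> - \<alpha> * b y y"
begin

definition \<gamma> where "\<gamma> = g a a"
definition r where "r x = g a x / \<gamma>"
definition Y where "Y x = x - r x *\<^sub>R a"
definition V where "V x = b (Y x) (Y x)"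

lemma \<gamma>: "\<gamma> > 0" using g_pos a_nonzero by (simp add: \<gamma>_def)

lemma linear_r: "linear r"
  unfolding r_def using g by (intro linearI) (simp_all add: bilinear_radd bilinear_rmul add_divide_distrib)

lemma linear_Y: "linear Y"
  unfolding Y_def
  by (intro linearI) (simp_all add: linear_add[OF linear_r] linear_scale[OF linear_r] algebra_simps)

lemma decompose: "x = r x *\<^sub>R a + Y x" by (simp add: Y_def)

lemma g_a_Y: "g a (Y x) = 0"
  using g \<gamma> by (simp add: Y_def r_def \<gamma>_def bilinear_rsub bilinear_rmul)

lemma Y_eq: "g a y = 0 \<Longrightarrow> Y y = y" by (simp add: Y_def r_def)

lemma energy: "g x x = (r x)\<^sup>2 * \<gamma> + g (Y x) (Y x)"
proof -
  have "g x x = g (r x *\<^sub>R a + Y x) (r x *\<^sub>R a + Y x)" using decompose by metis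
  also have "\<dots> = r x * (r x * \<gamma>) + g (Y x) (Y x)"
    using g g_a_Y g_sym[of "Y x" a]
    by (simp add: bilinear_ladd bilinear_radd bilinear_lmul bilinear_rmul \<gamma>_def)
  finally show ?thesis by (simp add: power2_eq_square)
qed

text \<open>The part of \<open>g (a + t y) (\<beta> (a + t y) (a + t y)) = 0\<close> linear in \<open>t\<close>.\<close>

lemma linearization_in_complement: "g a (\<beta> a y + \<beta> y a) = 0"
proof -
  let ?q = "\<lambda>t::real. g (a + t *\<^sub>R y) (\<beta> (a + t *\<^sub>R y) (a + t *\<^sub>R y))"
  \<comment> \<open>Averaging over \<open>t = 1\<close> and \<open>t = -1\<close> isolates the
    coefficient of \<open>t^2\<close>; the cubic one vanishes by the first integral at
    \<open>y\<close>, which leaves the linear one.\<close>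
  have "g a (\<beta> y y) + g y (\<beta> a y + \<beta> y a) = (?q 1 + ?q (-1)) / 2"
    using g \<beta> steady first_integral[of a] first_integral[of y]
    by (simp add: bilinear_ladd bilinear_radd bilinear_lsub bilinear_rsub bilinear_lneg bilinear_rneg bilinear_rzero)
  then have 1: "g a (\<beta> y y) + g y (\<beta> a y + \<beta> y a) = 0" by (simp only: first_integral add_0 div_0)
  have "?q 1 = g a (\<beta> a y + \<beta> y a) + (g a (\<beta> y y) + g y (\<beta> a y + \<beta> y a)) + g y (\<beta> y y)"
    using g \<beta> steady 
    by (simp add: bilinear_ladd bilinear_radd bilinear_rzero)
  then show ?thesis unfolding 1 first_integral by simp
qed

text \<open>An exact expansion: quadratic homogeneity puts the factor \<open>r x\<close> in front of
  the linearization, so the sign of \<open>r\<close> decides between contraction and expansion. The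
  linear term needs no projection, as it already lies in the complement.\<close>

lemma Y_field: "Y (\<beta> x x) = r x *\<^sub>R (\<beta> a (Y x) + \<beta> (Y x) a) + Y (\<beta> (Y x) (Y x))"
proof -
  have "\<beta> x x = \<beta> (r x *\<^sub>R a + Y x) (r x *\<^sub>R a + Y x)" using decompose by metis
  also have "\<dots> = r x *\<^sub>R (\<beta> a (Y x) + \<beta> (Y x) a) + \<beta> (Y x) (Y x)"
    using \<beta> steady by (simp add: bilinear_ladd bilinear_radd bilinear_lmul bilinear_rmul algebra_simps)
  finally show ?thesis
    by (simp only: linear_add[OF linear_Y, of "_ *\<^sub>R _"] linear_scale[OF linear_Y] Y_eq[OF linearization_in_complement])
qed

lemma V_lower: "(norm (Y x))\<^sup>2 \<le> V x" by (simp add: V_def b_lower)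

lemma V_nonneg: "V x \<ge> 0" using V_lower[of x] by (meson order_trans zero_le_power2)

lemma V_deriv:
  assumes "(x has_vector_derivative \<beta> (x t) (x t)) (at t within S)"
  shows "((\<lambda>t. V (x t)) has_real_derivative 2 * b (Y (x t)) (Y (\<beta> (x t) (x t)))) (at t within S)"
proof -
  have "((\<lambda>t. Y (x t)) has_vector_derivative Y (\<beta> (x t) (x t))) (at t within S)"
    using bounded_linear.has_vector_derivative[OF _ assms, of Y] linear_Y
    by (simp add: linear_conv_bounded_linear)
  then have "((\<lambda>t. b (Y (x t)) (Y (x t))) has_vector_derivative
      b (Y (x t)) (Y (\<beta> (x t) (x t))) + b (Y (\<beta> (x t) (x t))) (Y (x t))) (at t within S)"
    using b bounded_bilinear.has_vector_derivative[of b] by (simp add: bilinear_conv_bounded_bilinear)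
  then show ?thesis
    using b_sym[of "Y (\<beta> (x t) (x t))"] by (simp add: V_def has_real_derivative_iff_has_vector_derivative)
qed

lemma V_rate:
  "\<exists>\<eta>>0. \<forall>x. norm (Y x) \<le> \<eta> \<longrightarrow>
    (r x \<ge> 1 / 2 \<longrightarrow> 2 * b (Y x) (Y (\<beta> x x)) \<le> - (\<alpha> / 2) * V x) \<and>
    (r x \<le> - 1 / 2 \<longrightarrow> 2 * b (Y x) (Y (\<beta> x x)) \<ge> (\<alpha> / 2) * V x)"
proof -
  obtain B where B: "B > 0" "\<And>x y. norm (b x y) \<le> B * norm x * norm y"
    using bilinear_bounded[OF b] by blast
  obtain B' where B': "B' > 0" "\<And>x y. norm (\<beta> x y) \<le> B' * norm x * norm y"
    using bilinear_bounded[OF \<beta>] by blast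
  obtain B'' where B'': "B'' > 0" "\<And>x. norm (Y x) \<le> B'' * norm x"
    using linear_bounded_pos[OF linear_Y] by blast
  define C where "C = B * B' * B''"
  have C: "C > 0" using B B' B'' by (simp add: C_def)
  \<comment> \<open>For \<open>\<bar>r\<bar> \<ge> 1/2\<close> the linear term contributes at least
    \<open>\<alpha> * V\<close> in size; this radius keeps the cubic term below half of
    that.\<close>
  define \<eta> where "\<eta> = \<alpha> / (4 * C)"
  have cubic: "\<bar>2 * b (Y x) (Y (\<beta> (Y x) (Y x)))\<bar> \<le> \<alpha> / 2 * V x" if "norm (Y x) \<le> \<eta>" for x
  proof -
    let ?y = "Y x"
    have "\<bar>b ?y (Y (\<beta> ?y ?y))\<bar> \<le> B * norm ?y * norm (Y (\<beta> ?y ?y))"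
      using B(2)[of ?y "Y (\<beta> ?y ?y)"] by simp
    also have "\<dots> \<le> B * norm ?y * (B'' * (B' * norm ?y * norm ?y))"
      using B(1) B'(2)[of ?y ?y] B''(1)
      by (intro mult_left_mono order_trans[OF B''(2)]) auto
    also have "\<dots> = C * norm ?y * (norm ?y)\<^sup>2" by (simp add: C_def power2_eq_square)
    also have "\<dots> \<le> C * \<eta> * V x"
      using that C V_lower[of x] by (intro mult_mono) (auto simp: \<eta>_def \<alpha> less_imp_le)
    also have "C * \<eta> = \<alpha> / 4" using C by (simp add: \<eta>_def)
    finally show ?thesis by simp
  qed
  have split: "2 * b (Y x) (Y (\<beta> x x)) = 2 * r x * b (Y x) (\<beta> a (Y x) + \<beta> (Y x) a)
      + 2 * b (Y x) (Y (\<beta> (Y x) (Y x)))" for x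
    unfolding Y_field[of x] using b by (simp add: bilinear_radd bilinear_rmul del: scaleR_right_distrib)
  have lin: "b (Y x) (\<beta> a (Y x) + \<beta> (Y x) a) \<le> - \<alpha> * V x" for x
    unfolding V_def by (intro decay g_a_Y)
  have \<alpha>V: "\<alpha> * V x \<ge> 0" for x using \<alpha> V_nonneg[of x] by simp
  have "2 * b (Y x) (Y (\<beta> x x)) \<le> - (\<alpha> / 2) * V x" if x: "norm (Y x) \<le> \<eta>" "r x \<ge> 1 / 2" for x
  proof -
    have "2 * r x * b (Y x) (\<beta> a (Y x) + \<beta> (Y x) a) \<le> 2 * r x * (- \<alpha> * V x)"
      using lin x(2) by (intro mult_left_mono) auto
    also have "\<dots> \<le> - (\<alpha> * V x)"
      using mult_right_mono[of 1 "2 * r x", OF _ \<alpha>V[of x]] x(2) by simp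
    finally show ?thesis
      using cubic[OF x(1)] unfolding split by (simp add: abs_le_iff)
  qed
  moreover have "2 * b (Y x) (Y (\<beta> x x)) \<ge> (\<alpha> / 2) * V x" if x: "norm (Y x) \<le> \<eta>" "r x \<le> - 1 / 2" for x
  proof -
    have "\<alpha> * V x \<le> 2 * r x * (- \<alpha> * V x)"
      using mult_right_mono[of 1 "- 2 * r x", OF _ \<alpha>V[of x]] x(2) by simp
    also have "\<dots> \<le> 2 * r x * b (Y x) (\<beta> a (Y x) + \<beta> (Y x) a)"
      using lin x(2) by (intro mult_left_mono_neg) auto
    finally show ?thesis
      using cubic[OF x(1)] unfolding split by (simp add: abs_le_iff)
  qed
  moreover have "\<eta> > 0" using \<alpha> C by (simp add: \<eta>_def)
  ultimately show ?thesis by blast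
qed

section \<open>Solutions near \<open>a\<close> and near \<open>-a\<close>\<close>

lemma continuous_r: "continuous_on S f \<Longrightarrow> continuous_on S (\<lambda>x. r (f x))"
  and continuous_Y: "continuous_on S f \<Longrightarrow> continuous_on S (\<lambda>x. Y (f x))"
  using linear_r linear_Y
  by (auto simp: linear_conv_bounded_linear intro: bounded_linear.continuous_on)

lemma continuous_V: "continuous_on S f \<Longrightarrow> continuous_on S (\<lambda>x. V (f x))"
  unfolding V_def by (intro continuous_on_bilinear[OF b] continuous_Y)

lemma r_a: "r a = 1" using \<gamma> by (simp add: r_def \<gamma>_def)

lemma Y_a: "Y a = 0" by (simp add: Y_def r_a)

lemma V_a: "V a = 0" using b by (simp add: V_def Y_a bilinear_lzero)

text \<open>A general interval \<open>S\<close> covers both \<open>{0..<T}\<close>, for stability,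
  and \<open>{0..}\<close>, for attraction.\<close>

lemma solution_stays_near:
  assumes "\<epsilon> > 0"
  shows "\<exists>\<delta>>0. \<forall>x S. solution_on (\<lambda>x. \<beta> x x) x S \<and> convex S \<and> S \<subseteq> {0..} \<and> 0 \<in> S \<and> dist (x 0) a < \<delta> \<longrightarrow>
    (\<forall>t\<in>S. dist (x t) a < \<epsilon> \<and> r (x t) \<ge> 1 / 2 \<and> V (x t) \<le> V (x 0) * exp (- (\<alpha> / 2) * t))"
proof -
  obtain \<eta> where \<eta>: "\<eta> > 0"
    and rate: "\<And>x. norm (Y x) \<le> \<eta> \<Longrightarrow> r x \<ge> 1 / 2 \<Longrightarrow> 2 * b (Y x) (Y (\<beta> x x)) \<le> - (\<alpha> / 2) * V x"
    using V_rate by auto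
  obtain G where G: "G > 0" "\<And>x y. norm (g x y) \<le> G * norm x * norm y"
    using bilinear_bounded[OF g] by blast
  \<comment> \<open>The three bounds keep \<open>r \<ge> 1/2\<close>, make \<open>rate\<close>
    applicable, and turn closeness of \<open>r\<close> and \<open>Y\<close> into distance below
    \<open>\<epsilon>\<close>.\<close>
  define \<sigma> where "\<sigma> = min (1 / 2) (min \<eta> (\<epsilon> / (2 * (1 + norm a))))"
  have na: "1 + norm a > 0" by (simp add: add_pos_nonneg)
  have \<sigma>: "\<sigma> > 0" "\<sigma> \<le> 1 / 2" "\<sigma> \<le> \<eta>" "\<sigma> * (1 + norm a) < \<epsilon>"
  proof -
    show "\<sigma> > 0" using \<eta> \<open>\<epsilon> > 0\<close> na by (simp add: \<sigma>_def)
    show "\<sigma> \<le> 1 / 2" "\<sigma> \<le> \<eta>" unfolding \<sigma>_def by linarith+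
    have "\<sigma> \<le> \<epsilon> / (2 * (1 + norm a))" unfolding \<sigma>_def by linarith
    then have "\<sigma> * (1 + norm a) \<le> \<epsilon> / 2" using na by (simp add: field_simps)
    then show "\<sigma> * (1 + norm a) < \<epsilon>" using \<open>\<epsilon> > 0\<close> by linarith
  qed
  define Z where "Z x = V x + (r x - 1)\<^sup>2" for x
  \<comment> \<open>A bound for \<open>Z\<close> at later times in terms of the initial point alone:
    \<open>V\<close> does not grow, and conserved energy limits the drift of \<open>r^2\<close> from
    1. It vanishes at \<open>a\<close>, so small initial distance makes it small.\<close>
  define \<Theta> where "\<Theta> x = V x + (\<bar>g x x / \<gamma> - 1\<bar> + G / \<gamma> * V x)\<^sup>2" for x
  have Z_small: "norm (Y x) \<le> \<sigma>" "\<bar>r x - 1\<bar> \<le> \<sigma>" if "Z x \<le> \<sigma>\<^sup>2" for x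
  proof -
    have "(norm (Y x))\<^sup>2 \<le> \<sigma>\<^sup>2" using that V_lower[of x] zero_le_power2[of "r x - 1"] unfolding Z_def by linarith
    then show "norm (Y x) \<le> \<sigma>" using \<sigma>(1) by (simp add: power2_le_iff_abs_le)
    have "(r x - 1)\<^sup>2 \<le> \<sigma>\<^sup>2" using that V_nonneg[of x] by (simp add: Z_def)
    then show "\<bar>r x - 1\<bar> \<le> \<sigma>" using \<sigma>(1) by (simp add: power2_le_iff_abs_le)
  qed
  have "continuous_on UNIV (\<lambda>x. max (Z x) (\<Theta> x))"
    unfolding Z_def \<Theta>_def using \<gamma>
    by (intro continuous_intros continuous_V continuous_r continuous_on_bilinear[OF g]) auto
  moreover have "max (Z a) (\<Theta> a) = 0"
    using \<gamma> by (simp add: Z_def \<Theta>_def V_a r_a \<gamma>_def)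
  ultimately obtain \<delta> where \<delta>: "\<delta> > 0" "\<And>y. dist y a < \<delta> \<Longrightarrow> \<bar>max (Z y) (\<Theta> y)\<bar> < \<sigma>\<^sup>2"
    using \<sigma>(1) by (elim continuous_small_near_zero[of _ a "\<sigma>\<^sup>2"]) auto
  have "dist (x t) a < \<epsilon> \<and> r (x t) \<ge> 1 / 2 \<and> V (x t) \<le> V (x 0) * exp (- (\<alpha> / 2) * t)"
    if sol: "solution_on (\<lambda>x. \<beta> x x) x S" and S: "convex S" "S \<subseteq> {0..}" "0 \<in> S" and "t \<in> S"
      and near: "dist (x 0) a < \<delta>" for x S t
  proof -
    have sub: "{0..t} \<subseteq> S" if "t \<in> S" for t using convex_interval_subset S that by blast
    have "t \<ge> 0" using \<open>t \<in> S\<close> S by auto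
    have deriv: "(x has_vector_derivative \<beta> (x s) (x s)) (at s within {0..u})"
      if "u \<in> S" "0 \<le> s" "s \<le> u" for s u
      using solution_on_subset[OF sol sub[OF that(1)]] that by (simp add: solution_on_def)
    have cont_x: "continuous_on {0..t} x"
      unfolding continuous_on_eq_continuous_within
      by (intro ballI has_vector_derivative_continuous[OF deriv[OF \<open>t \<in> S\<close>]]) auto
    have decays: "V (x s) \<le> V (x 0) * exp (- (\<alpha> / 2) * s)"
      if s: "s \<in> S" "\<And>u. 0 \<le> u \<Longrightarrow> u \<le> s \<Longrightarrow> Z (x u) \<le> \<sigma>\<^sup>2" for s
    proof (rule exponential_decay_bound)
      show "0 \<le> s" using s(1) S(2) by auto
      fix u assume u: "0 \<le> u" "u \<le> s"
      show "((\<lambda>t. V (x t)) has_real_derivative 2 * b (Y (x u)) (Y (\<beta> (x u) (x u)))) (at u within {0..s})"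
        by (intro V_deriv deriv s(1) u)
      show "2 * b (Y (x u)) (Y (\<beta> (x u) (x u))) \<le> - (\<alpha> / 2) * V (x u)"
        using Z_small[OF s(2)[OF u]] \<sigma> by (intro rate) linarith+
    qed
    have Z_t: "Z (x s) < \<sigma>\<^sup>2" if s: "0 \<le> s" "s \<le> t" for s
    proof (rule trapped_below_level[of s "\<lambda>s. Z (x s)"])
      show "0 \<le> s" by fact
      show "continuous_on {0..s} (\<lambda>s. Z (x s))"
        unfolding Z_def using continuous_on_subset[OF cont_x, of "{0..s}"] s
        by (intro continuous_intros continuous_V continuous_r) auto
      show "Z (x 0) < \<sigma>\<^sup>2" using \<delta>(2)[OF near] by simp
      fix u assume u: "0 \<le> u" "u \<le> s" and below: "\<And>v. 0 \<le> v \<Longrightarrow> v \<le> u \<Longrightarrow> Z (x v) \<le> \<sigma>\<^sup>2"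
      have "u \<in> S" using sub[OF \<open>t \<in> S\<close>] u s by auto
      have "exp (- (\<alpha> / 2) * u) \<le> 1" using \<alpha> u by simp
      then have V_le: "V (x u) \<le> V (x 0)"
        using decays[OF \<open>u \<in> S\<close> below] V_nonneg[of "x 0"]
        by (smt (verit) mult_left_le)
      have r_near: "\<bar>r (x u) - 1\<bar> \<le> 1 / 2" using Z_small(2)[OF below, of u] u \<sigma>(2) by simp
      have "g (x u) (x u) = g (x 0) (x 0)"
        by (rule quadratic_first_integral[of g "\<lambda>x. \<beta> x x", OF g g_sym first_integral sol S(1) \<open>u \<in> S\<close> S(3)])
      then have "g (x 0) (x 0) - g (Y (x u)) (Y (x u)) = (r (x u))\<^sup>2 * \<gamma>"
        using energy[of "x u"] by linarith
      then have r2: "(r (x u))\<^sup>2 = (g (x 0) (x 0) - g (Y (x u)) (Y (x u))) / \<gamma>"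
        using \<gamma> by simp
      have "g (Y (x u)) (Y (x u)) \<ge> 0"
        using g_pos[of "Y (x u)"] g by (cases "Y (x u) = 0") (auto simp: bilinear_lzero less_imp_le)
      moreover have "g (Y (x u)) (Y (x u)) \<le> G * V (x 0)"
      proof -
        have "g (Y (x u)) (Y (x u)) \<le> G * (norm (Y (x u)))\<^sup>2"
          using G(2)[of "Y (x u)" "Y (x u)"] by (simp add: power2_eq_square)
        also have "\<dots> \<le> G * V (x 0)"
          using G(1) V_le V_lower[of "x u"] by (intro mult_left_mono) auto
        finally show ?thesis .
      qed
      ultimately have "\<bar>g (Y (x u)) (Y (x u)) / \<gamma>\<bar> \<le> G / \<gamma> * V (x 0)"
        using \<gamma> by (simp add: divide_right_mono)
      then have "\<bar>(r (x u))\<^sup>2 - 1\<bar> \<le> \<bar>g (x 0) (x 0) / \<gamma> - 1\<bar> + G / \<gamma> * V (x 0)"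
        unfolding r2 diff_divide_distrib by linarith
      \<comment> \<open>Passing from \<open>r^2\<close> to \<open>r\<close> uses that
        \<open>r\<close> is positive, so that \<open>r + 1 \<ge> 1\<close>.\<close>
      moreover have "\<bar>r (x u) - 1\<bar> \<le> \<bar>(r (x u))\<^sup>2 - 1\<bar>"
      proof -
        have "(r (x u))\<^sup>2 - 1 = (r (x u) - 1) * (r (x u) + 1)" by (simp add: power2_eq_square algebra_simps)
        then have "\<bar>(r (x u))\<^sup>2 - 1\<bar> = \<bar>r (x u) - 1\<bar> * \<bar>r (x u) + 1\<bar>" by (simp add: abs_mult)
        moreover have "1 \<le> \<bar>r (x u) + 1\<bar>" using r_near by linarith
        ultimately show ?thesis using mult_left_mono[of 1 "\<bar>r (x u) + 1\<bar>" "\<bar>r (x u) - 1\<bar>"] by simp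
      qed
      ultimately have "(r (x u) - 1)\<^sup>2 \<le> (\<bar>g (x 0) (x 0) / \<gamma> - 1\<bar> + G / \<gamma> * V (x 0))\<^sup>2"
        by (intro power2_le_iff_abs_le[THEN iffD2]) auto
      then have "Z (x u) \<le> \<Theta> (x 0)" using V_le by (simp add: Z_def \<Theta>_def)
      then show "Z (x u) < \<sigma>\<^sup>2" using \<delta>(2)[OF near] by simp
    qed
    have small: "norm (Y (x t)) \<le> \<sigma>" "\<bar>r (x t) - 1\<bar> \<le> \<sigma>"
      using Z_small[of "x t"] Z_t[of t] \<open>t \<ge> 0\<close> by auto
    have "x t - a = (r (x t) - 1) *\<^sub>R a + Y (x t)" by (simp add: Y_def algebra_simps)
    then have "dist (x t) a \<le> \<bar>r (x t) - 1\<bar> * norm a + norm (Y (x t))"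
      using norm_triangle_ineq[of "(r (x t) - 1) *\<^sub>R a" "Y (x t)"] by (simp add: dist_norm)
    also have "\<dots> \<le> \<sigma> * norm a + \<sigma>" using small by (intro add_mono mult_right_mono) auto
    finally have "dist (x t) a < \<epsilon>" using \<sigma>(4) by (simp add: algebra_simps)
    moreover have "r (x t) \<ge> 1 / 2" using small \<sigma>(2) by linarith
    moreover have "V (x t) \<le> V (x 0) * exp (- (\<alpha> / 2) * t)"
      using Z_t \<open>t \<in> S\<close> by (intro decays) (auto intro: less_imp_le)
    ultimately show ?thesis by blast
  qed
  then show ?thesis using \<delta>(1) by blast
qed

lemma stable: "lyapunov_stable (\<lambda>x. \<beta> x x) a"
  unfolding lyapunov_stable_def
proof (intro allI impI)
  fix \<epsilon> :: real assume "\<epsilon> > 0"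
  from solution_stays_near[OF this] obtain \<delta> where \<delta>: "\<delta> > 0"
    and stays: "\<forall>x S. solution_on (\<lambda>x. \<beta> x x) x S \<and> convex S \<and> S \<subseteq> {0..} \<and> 0 \<in> S \<and> dist (x 0) a < \<delta> \<longrightarrow>
      (\<forall>t\<in>S. dist (x t) a < \<epsilon> \<and> r (x t) \<ge> 1 / 2 \<and> V (x t) \<le> V (x 0) * exp (- (\<alpha> / 2) * t))"
    by blast
  have "\<forall>t\<in>{0..<T}. dist (x t) a < \<epsilon>"
    if "T > 0" "solution_on (\<lambda>x. \<beta> x x) x {0..<T}" "dist (x 0) a < \<delta>" for T x
  proof -
    have "{0..<T} \<subseteq> {0..}" by auto
    then show ?thesis using stays[rule_format, of x "{0..<T}"] that by auto
  qed
  then show "\<exists>\<delta>>0. \<forall>T>0. \<forall>x. solution_on (\<lambda>x. \<beta> x x) x {0..<T} \<and> dist (x 0) a < \<delta> \<longrightarrow> (\<forall>t\<in>{0..<T}. dist (x t) a < \<epsilon>)"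
    using \<delta> by blast
qed

text \<open>Once \<open>Y\<close> tends to 0, the conserved energy forces \<open>r^2\<close> to
  converge, and \<open>r \<ge> 1/2\<close> makes \<open>r\<close> its positive square root; hence
  \<open>\<mu> = sqrt (g (x 0) (x 0) / \<gamma>)\<close>.\<close>

lemma attracted:
  "\<exists>\<delta>>0. \<forall>x. solution_on (\<lambda>x. \<beta> x x) x {0..} \<and> dist (x 0) a < \<delta> \<longrightarrow> (\<exists>\<mu>. (x \<longlongrightarrow> \<mu> *\<^sub>R a) at_top)"
proof -
  from solution_stays_near[OF zero_less_one] obtain \<delta> where \<delta>: "\<delta> > 0"
    and stays: "\<forall>x S. solution_on (\<lambda>x. \<beta> x x) x S \<and> convex S \<and> S \<subseteq> {0..} \<and> 0 \<in> S \<and> dist (x 0) a < \<delta> \<longrightarrow>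
      (\<forall>t\<in>S. dist (x t) a < 1 \<and> r (x t) \<ge> 1 / 2 \<and> V (x t) \<le> V (x 0) * exp (- (\<alpha> / 2) * t))"
    by blast
  have "\<exists>\<mu>. (x \<longlongrightarrow> \<mu> *\<^sub>R a) at_top"
    if sol: "solution_on (\<lambda>x. \<beta> x x) x {0..}" and near: "dist (x 0) a < \<delta>" for x
  proof -
    have r_pos: "r (x t) \<ge> 1 / 2" and V_le: "V (x t) \<le> V (x 0) * exp (- (\<alpha> / 2) * t)" if "t \<ge> 0" for t
      using stays[rule_format, of x "{0..}" t] sol near that by auto
    have "filterlim (\<lambda>t. - (\<alpha> / 2) * t) at_bot at_top"
      using \<alpha> by (intro filterlim_tendsto_neg_mult_at_bot[OF tendsto_const]) (auto simp: filterlim_ident)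
    then have "((\<lambda>t. V (x 0) * exp (- (\<alpha> / 2) * t)) \<longlongrightarrow> V (x 0) * 0) at_top"
      by (intro tendsto_mult tendsto_const filterlim_compose[OF exp_at_bot])
    then have V_lim: "((\<lambda>t. V (x 0) * exp (- (\<alpha> / 2) * t)) \<longlongrightarrow> 0) at_top" by simp
    have "((\<lambda>t. (norm (Y (x t)))\<^sup>2) \<longlongrightarrow> 0) at_top"
    proof (rule tendsto_sandwich[OF _ _ tendsto_const V_lim])
      show "\<forall>\<^sub>F t in at_top. (norm (Y (x t)))\<^sup>2 \<le> V (x 0) * exp (- (\<alpha> / 2) * t)"
        using eventually_ge_at_top[of 0] by eventually_elim (rule order_trans[OF V_lower V_le])
    qed simp
    from tendsto_real_sqrt[OF this] have Y_lim: "((\<lambda>t. Y (x t)) \<longlongrightarrow> 0) at_top"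
      by (simp add: tendsto_norm_zero_iff)
    have "bounded_bilinear g" using g by (simp add: bilinear_conv_bounded_bilinear)
    from bounded_bilinear.tendsto[OF this Y_lim Y_lim]
    have "((\<lambda>t. g (Y (x t)) (Y (x t))) \<longlongrightarrow> 0) at_top" using g by (simp add: bilinear_lzero)
    then have "((\<lambda>t. sqrt ((g (x 0) (x 0) - g (Y (x t)) (Y (x t))) / \<gamma>)) \<longlongrightarrow>
        sqrt ((g (x 0) (x 0) - 0) / \<gamma>)) at_top"
      using \<gamma> by (intro tendsto_intros) auto
    moreover have "sqrt ((g (x 0) (x 0) - g (Y (x t)) (Y (x t))) / \<gamma>) = r (x t)" if "t \<ge> 0" for t
    proof -
      have "g (x t) (x t) = g (x 0) (x 0)"
        by (rule quadratic_first_integral[of g "\<lambda>x. \<beta> x x", OF g g_sym first_integral sol]) (use that in auto)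
      then have "g (x 0) (x 0) - g (Y (x t)) (Y (x t)) = (r (x t))\<^sup>2 * \<gamma>"
        using energy[of "x t"] by linarith
      then show ?thesis using r_pos[OF that] \<gamma> by simp
    qed
    ultimately have "((\<lambda>t. r (x t)) \<longlongrightarrow> sqrt ((g (x 0) (x 0) - 0) / \<gamma>)) at_top"
      by (elim Lim_transform_eventually) (auto simp: eventually_at_top_linorder intro!: exI[of _ 0])
    from tendsto_add[OF tendsto_scaleR[OF this tendsto_const[of a]] Y_lim]
    have "((\<lambda>t. r (x t) *\<^sub>R a + Y (x t)) \<longlongrightarrow> sqrt ((g (x 0) (x 0) - 0) / \<gamma>) *\<^sub>R a) at_top"
      by simp
    then show ?thesis unfolding decompose[symmetric] by blast
  qed
  then show ?thesis using \<delta> by blast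
qed

text \<open>Dimension at least 2 supplies a direction \<open>y\<close> in the complement. Starting
  from \<open>-a\<close> displaced along \<open>y\<close>, stability would confine the global
  solution to a region where \<open>V\<close> is bounded yet grows exponentially.\<close>

lemma unstable_opposite:
  assumes "DIM('a) \<ge> 2"
  shows "\<not> lyapunov_stable (\<lambda>x. \<beta> x x) (- a)"
proof
  assume stable: "lyapunov_stable (\<lambda>x. \<beta> x x) (- a)"
  obtain y where y: "y \<noteq> 0" "g a y = 0"
  proof -
    have "dim (span {a}) \<le> 1" using dim_le_card'[of "{a}"] by simp
    then have "span {a} \<noteq> UNIV" using assms by (metis Suc_1 dim_UNIV not_less_eq_eq)
    then obtain u where u: "u \<notin> span {a}" by blast
    have "Y u \<noteq> 0"
      using u span_mul[OF span_base, of a "{a}" "r u"] by (auto simp: Y_def)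
    then show thesis using that g_a_Y by blast
  qed
  obtain \<eta> where \<eta>: "\<eta> > 0"
    and rate: "\<And>x. norm (Y x) \<le> \<eta> \<Longrightarrow> r x \<le> - 1 / 2 \<Longrightarrow> 2 * b (Y x) (Y (\<beta> x x)) \<ge> (\<alpha> / 2) * V x"
    using V_rate by auto
  have "continuous_on UNIV (\<lambda>x. max (r x + 1) (max (norm (Y x)) (V x)))"
    by (intro continuous_intros continuous_r continuous_Y continuous_V)
  moreover have "r (- a) = - 1" "Y (- a) = 0" "V (- a) = 0"
    using r_a Y_a linear_neg[OF linear_r, of a] linear_neg[OF linear_Y, of a] b
    by (simp_all add: V_def bilinear_lzero)
  ultimately obtain \<epsilon> where \<epsilon>: "\<epsilon> > 0"
    and small: "\<And>x. dist x (- a) < \<epsilon> \<Longrightarrow> \<bar>max (r x + 1) (max (norm (Y x)) (V x))\<bar> < min (1 / 2) \<eta>"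
    using \<eta> by (elim continuous_small_near_zero[of _ "- a" "min (1 / 2) \<eta>"]) auto
  have near: "r x \<le> - 1 / 2 \<and> norm (Y x) \<le> \<eta> \<and> V x < 1 / 2" if "dist x (- a) < \<epsilon>" for x
  proof -
    have "max (r x + 1) (max (norm (Y x)) (V x)) < 1 / 2" "max (r x + 1) (max (norm (Y x)) (V x)) < \<eta>"
      using small[OF that] by linarith+
    then show ?thesis unfolding max_less_iff_conj by linarith
  qed
  obtain \<delta> where \<delta>: "\<delta> > 0"
    and stays: "\<And>T x t. T > 0 \<Longrightarrow> solution_on (\<lambda>x. \<beta> x x) x {0..<T} \<Longrightarrow> dist (x 0) (- a) < \<delta> \<Longrightarrow>
      t \<in> {0..<T} \<Longrightarrow> dist (x t) (- a) < \<epsilon>"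
    using stable[unfolded lyapunov_stable_def, rule_format, OF \<epsilon>] by blast
  define s where "s = \<delta> / (2 * norm y)"
  have s: "s > 0" "s * norm y < \<delta>" using \<delta> y by (auto simp: s_def)
  obtain x where sol: "solution_on (\<lambda>x. \<beta> x x) x {0..}" and x0: "x 0 = - a + s *\<^sub>R y"
    using quadratic_flow_global_solution[of \<beta> g, OF \<beta> g g_sym g_pos first_integral] by blast
  have "Y (x 0) = s *\<^sub>R y"
    unfolding x0 by (simp add: linear_diff[OF linear_Y] linear_scale[OF linear_Y] Y_a Y_eq y)
  then have V0: "V (x 0) > 0"
    using s(1) y(1) by (intro less_le_trans[OF _ V_lower]) simp
  have close: "dist (x t) (- a) < \<epsilon>" if "t \<ge> 0" for t
  proof (rule stays[of "t + 1" x t])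
    show "solution_on (\<lambda>x. \<beta> x x) x {0..<t + 1}"
      by (rule solution_on_subset[OF sol]) auto
    show "dist (x 0) (- a) < \<delta>" using s by (simp add: x0 dist_norm)
  qed (use that in auto)
  have growth: "V (x 0) * exp (\<alpha> / 2 * t) \<le> V (x t)" if "t \<ge> 0" for t
  proof -
    have "- V (x t) \<le> - V (x 0) * exp (- (- \<alpha> / 2) * t)"
    proof (rule exponential_decay_bound[OF that])
      fix u assume u: "0 \<le> u" "u \<le> t"
      have "(x has_vector_derivative \<beta> (x u) (x u)) (at u within {0..t})"
        using solution_on_subset[OF sol, of "{0..t}"] u by (simp add: solution_on_def)
      from DERIV_minus[OF V_deriv[OF this]]
      show "((\<lambda>t. - V (x t)) has_real_derivative - (2 * b (Y (x u)) (Y (\<beta> (x u) (x u))))) (at u within {0..t})" .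
      have "\<alpha> / 2 * V (x u) \<le> 2 * b (Y (x u)) (Y (\<beta> (x u) (x u)))"
        using near[OF close[OF u(1)]] by (intro rate) auto
      then show "- (2 * b (Y (x u)) (Y (\<beta> (x u) (x u)))) \<le> - (- \<alpha> / 2) * - V (x u)" by simp
    qed
    then show ?thesis by simp
  qed
  \<comment> \<open>Even the linear lower bound \<open>1 + \<alpha> / 2 * t\<close> for the
    exponential then gives \<open>V (x 0) + 1 / 2\<close>, beyond the bound 1/2 valid near
    \<open>-a\<close>.\<close>
  define t where "t = 1 / (\<alpha> * V (x 0))"
  have t: "t > 0" using V0 \<alpha> by (simp add: t_def)
  have "1 / 2 < V (x 0) * (1 + \<alpha> / 2 * t)" using V0 \<alpha> by (simp add: t_def field_simps)
  also have "\<dots> \<le> V (x 0) * exp (\<alpha> / 2 * t)" using V0 by (intro mult_left_mono exp_ge_add_one_self) auto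
  also have "\<dots> \<le> V (x t)" using growth t by simp
  also have "\<dots> < 1 / 2" using near[OF close, of t] t by simp
  finally show False .
qed

end

section \<open>The reduced system\<close>

context eps_system
begin

text \<open>A polarization that is not symmetrized: \<open>x\<close> enters through the momentum and
  \<open>y\<close> through the velocity. The derivative at \<open>a\<close> is therefore a sum of
  two terms.\<close>

definition eps_bilinear :: "real^'p \<Rightarrow> real^'p \<Rightarrow> real^'p" where
  "eps_bilinear x y = matrix_inv (reduced_inertia J emb) *v
     (\<chi> i. \<Sum>j\<in>UNIV. \<Sum>k\<in>UNIV. c (emb j) (emb i) k * (\<Sum>l\<in>UNIV. J $ k $ emb l * x $ l) * y $ j)"

definition inertia_form :: "real^'p \<Rightarrow> real^'p \<Rightarrow> real" where
  "inertia_form x y = x \<bullet> (reduced_inertia J emb *v y)"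

lemma eps_field_eq: "eps_field c J emb = (\<lambda>x. eps_bilinear x x)"
  by (rule ext) (simp add: eps_field_def eps_rhs_def eps_bilinear_def)

lemma bilinear_eps_bilinear: "bilinear eps_bilinear"
proof -
  let ?h = "\<lambda>x y :: real^'p. (\<chi> i. \<Sum>j\<in>UNIV. \<Sum>k\<in>UNIV.
      c (emb j) (emb i) k * (\<Sum>l\<in>UNIV. J $ k $ emb l * x $ l) * y $ j) :: real^'p"
  have "linear (\<lambda>x. ?h x y)" for y
    by (rule linearI) (simp_all add: vec_eq_iff ring_distribs sum.distrib sum_distrib_left mult_ac)
  moreover have "linear (?h x)" for x
    by (rule linearI) (simp_all add: vec_eq_iff ring_distribs sum.distrib sum_distrib_left mult_ac)
  ultimately show ?thesis
    unfolding bilinear_def eps_bilinear_def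
    using linear_compose[OF _ matrix_vector_mul_linear, unfolded o_def] by blast
qed

lemma bilinear_inertia_form: "bilinear inertia_form"
  unfolding bilinear_def inertia_form_def
  by (auto intro!: linearI simp: inner_add matrix_vector_right_distrib matrix_vector_mult_scaleR)

lemma inertia_form_sym: "inertia_form x y = inertia_form y x"
proof -
  have "J $ i $ j = J $ j $ i" for i j
    using inertia_symmetric by (metis transpose_def vec_lambda_beta)
  then have "transpose (reduced_inertia J emb) = reduced_inertia J emb"
    by (simp add: vec_eq_iff transpose_def reduced_inertia_def)
  then have "inertia_form x y = (reduced_inertia J emb *v x) \<bullet> y"
    by (metis inertia_form_def dot_lmul_matrix transpose_matrix_vector)
  then show ?thesis by (simp add: inertia_form_def inner_commute)
qed

lemma inertia_form_pos:
  assumes "y \<noteq> 0"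
  shows "inertia_form y y > 0"
proof -
  \<comment> \<open>Extension by zero in the constrained coordinates carries positivity of
    \<open>J\<close> over to the reduced inertia.\<close>
  define x :: "real^'n" where "x = (\<chi> i. if i \<in> range emb then y $ inv emb i else 0)"
  have xe: "x $ emb a = y $ a" for a
    using emb_inj by (simp add: x_def)
  have red: "(\<Sum>i\<in>UNIV. f i * x $ i) = (\<Sum>a\<in>UNIV. f (emb a) * y $ a)" for f
  proof -
    have "(\<Sum>i\<in>UNIV. f i * x $ i) = (\<Sum>i\<in>range emb. f i * x $ i)"
      by (rule sum.mono_neutral_right) (auto simp: x_def)
    also have "\<dots> = (\<Sum>a\<in>UNIV. f (emb a) * y $ a)"
      using emb_inj by (simp add: sum.reindex xe)
    finally show ?thesis .
  qed
  have "x \<noteq> 0"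
    using assms xe by (metis vec_eq_iff zero_index)
  then have "0 < x \<bullet> (J *v x)" by (rule inertia_pos_def)
  also have "x \<bullet> (J *v x) = (\<Sum>i\<in>UNIV. (J *v x) $ i * x $ i)"
    by (simp add: inner_vec_def mult.commute)
  also have "\<dots> = (\<Sum>a\<in>UNIV. (reduced_inertia J emb *v y) $ a * y $ a)"
    unfolding red by (simp add: matrix_vector_mult_def reduced_inertia_def red)
  also have "\<dots> = inertia_form y y"
    by (simp add: inertia_form_def inner_vec_def mult.commute)
  finally show ?thesis .
qed

lemma structure_constants_antisym: "c i j k = - c j i k"
proof -
  have "0 = bracket (w i + w j) (w i + w j)" by (simp only: bracket_self)
  also have "\<dots> = bracket (w j) (w i) + bracket (w i) (w j)"
    by (simp only: bilinear_ladd[OF bilinear_bracket] bilinear_radd[OF bilinear_bracket]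
        bracket_self[of "w i"] bracket_self[of "w j"] add_0_left add_0_right)
  finally have "bracket (w i) (w j) + bracket (w j) (w i) = 0"
    by (simp add: add.commute)
  then have "(\<Sum>k\<in>UNIV. (c i j k + c j i k) *\<^sub>R w k) = 0"
    unfolding structure_constants by (simp add: scaleR_left_distrib sum.distrib)
  then have "(\<Sum>v\<in>range w. (c i j (inv w v) + c j i (inv w v)) *\<^sub>R v) = 0"
    using basis_inj by (simp add: sum.reindex)
  then have "c i j (inv w (w k)) + c j i (inv w (w k)) = 0"
    by (rule independentD[OF basis_independent, rotated 2]) auto
  then show ?thesis using basis_inj by simp
qed

text \<open>The reduced inertia cancels its inverse, leaving a double sum whose terms change sign
  under exchange of \<open>i\<close> and \<open>j\<close> by antisymmetry of the structure
  constants.\<close>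

lemma energy_first_integral: "inertia_form x (eps_bilinear x x) = 0"
proof -
  have "reduced_inertia J emb *v eps_bilinear x x = eps_rhs c J emb x"
    using eps_field_iff[of "eps_field c J emb x" x] by (simp add: eps_field_eq)
  then have "inertia_form x (eps_bilinear x x) = x \<bullet> eps_rhs c J emb x"
    by (simp add: inertia_form_def)
  also have "\<dots> = (\<Sum>i\<in>UNIV. \<Sum>j\<in>UNIV. (\<Sum>k\<in>UNIV. c (emb j) (emb i) k * (\<Sum>l\<in>UNIV. J $ k $ emb l * x $ l)) * x $ j * x $ i)"
    (is "_ = (\<Sum>i\<in>UNIV. \<Sum>j\<in>UNIV. ?f i j)")
    by (simp add: inner_vec_def eps_rhs_def sum_distrib_left sum_distrib_right mult_ac)
  finally have S: "inertia_form x (eps_bilinear x x) = (\<Sum>i\<in>UNIV. \<Sum>j\<in>UNIV. ?f i j)" .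
  have "?f i j = - ?f j i" for i j
    by (subst structure_constants_antisym) (simp add: sum_negf mult_ac)
  then have "(\<Sum>i\<in>UNIV. \<Sum>j\<in>UNIV. ?f i j) = (\<Sum>i\<in>UNIV. \<Sum>j\<in>UNIV. - ?f j i)"
    by (intro sum.cong refl)
  also have "\<dots> = - (\<Sum>j\<in>UNIV. \<Sum>i\<in>UNIV. ?f j i)"
    unfolding sum_negf by (subst sum.swap) (rule refl)
  finally show ?thesis unfolding S by linarith
qed

lemma jacobian_eps_field:
  "jacobian (eps_field c J emb) (at a) *v h = eps_bilinear a h + eps_bilinear h a"
proof -
  have "bounded_bilinear eps_bilinear"
    using bilinear_eps_bilinear by (simp add: bilinear_conv_bounded_bilinear)
  then have d: "(eps_field c J emb has_derivative (\<lambda>h. eps_bilinear a h + eps_bilinear h a)) (at a)"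
    unfolding eps_field_eq by (rule bounded_bilinear.FDERIV) (rule has_derivative_ident)+
  then have "eps_field c J emb differentiable (at a)" by (rule differentiableI)
  then have "(eps_field c J emb has_derivative (\<lambda>h. jacobian (eps_field c J emb) (at a) *v h)) (at a)"
    by (rule jacobian_works[THEN iffD1])
  from fun_cong[OF has_derivative_unique[OF this d]] show ?thesis .
qed

lemma attracting_steady_motion:
  assumes card: "CARD('p) \<ge> 2" and a: "a \<noteq> 0" "eps_field c J emb a = 0"
    and stable: "stable_degree (eps_field c J emb) a = CARD('p) - 1"
  obtains b \<alpha> where "attracting_steady_line eps_bilinear inertia_form a b \<alpha>"
proof -
  define A where "A = jacobian (eps_field c J emb) (at a)"
  have A: "A *v h = eps_bilinear a h + eps_bilinear h a" for h
    by (simp add: A_def jacobian_eps_field)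
  have steady: "eps_bilinear a a = 0" using a(2) by (simp add: eps_field_eq)
  \<comment> \<open>The energy pairing with \<open>a\<close>, normalized by
    \<open>l \<bullet> a = 1\<close>. Its kernel is the complement of \<open>a\<close>, so
    \<open>B\<close> vanishes there and the decay for \<open>A + B\<close> is the decay for
    \<open>A\<close>.\<close>
  define l where "l = (1 / inertia_form a a) *\<^sub>R (reduced_inertia J emb *v a)"
  have l: "l \<bullet> y = inertia_form a y / inertia_form a a" for y
    using inertia_form_sym[of a y] by (simp add: l_def inertia_form_def inner_commute)
  define B :: "real^'p^'p" where "B = (\<chi> i j. - (a $ i * l $ j))"
  have B: "B *v y = - (l \<bullet> y) *\<^sub>R a" for y
    by (simp add: B_def vec_eq_iff matrix_vector_mult_def inner_vec_def sum_negf sum_distrib_left sum_distrib_right mult_ac)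
  have "Re z < 0" if "poly (charpoly (A + B)) z = 0" for z
  proof (rule hurwitz_deflation[OF _ card _ _ B_def that])
    show "size {# z \<in># proots (charpoly A). Re z < 0 #} = CARD('p) - 1"
      using stable by (simp add: stable_degree_def A_def)
    show "A *v a = 0" by (simp add: A steady)
    show "l \<bullet> a = 1" using inertia_form_pos[OF a(1)] by (simp add: l)
  qed
  then obtain b \<alpha> where b: "bilinear b" "\<And>x y. b x y = (b y x :: real)" "\<alpha> > 0"
    "\<And>y. (norm y)\<^sup>2 \<le> b y y" "\<And>y. b y ((A + B) *v y) \<le> - \<alpha> * b y y"
    using hurwitz_lyapunov_form[of "A + B"] by auto
  have "b y (eps_bilinear a y + eps_bilinear y a) \<le> - \<alpha> * b y y" if "inertia_form a y = 0" for y
    using b(5)[of y] that by (simp add: matrix_vector_mult_add_rdistrib A B l)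
  then have "attracting_steady_line eps_bilinear inertia_form a b \<alpha>"
    using bilinear_eps_bilinear bilinear_inertia_form inertia_form_sym inertia_form_pos
      energy_first_integral a(1) steady b(1-4)
    by unfold_locales auto
  then show thesis by (rule that)
qed

end

theorem mainTheorem3:
  fixes bracket :: "'g::real_vector \<Rightarrow> 'g \<Rightarrow> 'g"
    and w :: "'n::finite \<Rightarrow> 'g"
    and c :: "'n \<Rightarrow> 'n \<Rightarrow> 'n \<Rightarrow> real"
    and J :: "real^'n^'n"
    and emb :: "'p::finite \<Rightarrow> 'n"
    and m :: nat
    and \<omega>\<^sub>0 :: "real^'p"
  assumes "eps_system bracket w c J emb"
    and "m < CARD('n)" and "CARD('p) = CARD('n) - m" and "CARD('p) \<ge> 2"
    and "\<omega>\<^sub>0 \<noteq> 0" and "eps_field c J emb \<omega>\<^sub>0 = 0"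
    and "stable_degree (eps_field c J emb) \<omega>\<^sub>0 = CARD('n) - m - 1"
  shows "lyapunov_stable (eps_field c J emb) \<omega>\<^sub>0 \<and>
    (\<exists>\<delta>>0. \<forall>a. dist a \<omega>\<^sub>0 < \<delta> \<longrightarrow>
       (\<exists>x. solution_on (eps_field c J emb) x {0..} \<and> x 0 = a) \<and>
       (\<forall>x. solution_on (eps_field c J emb) x {0..} \<and> x 0 = a \<longrightarrow>
          (\<exists>\<mu>. (x \<longlongrightarrow> \<mu> *\<^sub>R \<omega>\<^sub>0) at_top))) \<and>
    \<not> lyapunov_stable (eps_field c J emb) (- \<omega>\<^sub>0)"
proof -
  interpret eps_system bracket w c J emb by fact
  have "stable_degree (eps_field c J emb) \<omega>\<^sub>0 = CARD('p) - 1" using assms(3,7) by simp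
  then obtain b \<alpha> where "attracting_steady_line eps_bilinear inertia_form \<omega>\<^sub>0 b \<alpha>"
    using attracting_steady_motion[OF assms(4-6)] by blast
  then interpret attracting_steady_line eps_bilinear inertia_form \<omega>\<^sub>0 b \<alpha> .
  have "\<exists>x. solution_on (eps_field c J emb) x {0..} \<and> x 0 = a" for a
    unfolding eps_field_eq
    using quadratic_flow_global_solution[of eps_bilinear inertia_form, OF \<beta> g g_sym g_pos first_integral] .
  moreover have "\<exists>\<delta>>0. \<forall>x. solution_on (eps_field c J emb) x {0..} \<and> dist (x 0) \<omega>\<^sub>0 < \<delta> \<longrightarrow>
      (\<exists>\<mu>. (x \<longlongrightarrow> \<mu> *\<^sub>R \<omega>\<^sub>0) at_top)"
    using attracted by (simp add: eps_field_eq)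
  moreover have "lyapunov_stable (eps_field c J emb) \<omega>\<^sub>0"
    using stable by (simp add: eps_field_eq)
  moreover have "\<not> lyapunov_stable (eps_field c J emb) (- \<omega>\<^sub>0)"
    using unstable_opposite assms(4) by (simp add: eps_field_eq)
  ultimately show ?thesis by blast
qed

end
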